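(* Let $f:\mathbb{D}\to\widehat{\mathbb{C}}$ be a centrally normalized spherically convex function. Then $$\mathcal{L}_s(r):=\frac{L_s f(r\mathbb{T})}{L_s(r\mathbb{T})}$$ is a strictly increasing function of $r\in(0,1)$, unless $f$ is a spherical isometry, in which case $\mathcal{L}_s(r)\equiv 1$.
   Context: $\mathbb{D}=\{z\in\mathbb{C}:|z|<1\}$, $\mathbb{T}=\partial\mathbb{D}$, $r\mathbb{T}=\{|z|=r\}$; $\widehat{\mathbb{C}}=\mathbb{C}\cup\{\infty\}$ is the Riemann sphere with the spherical metric $\frac{|dz|}{1+|z|^2}$ (Gaussian curvature $+4$). For two non-antipodal points $a,b\in\widehat{\mathbb{C}}$, the spherical geodesic joining them is the smaller arc of the great circle through $a$ and $b$. A domain $\Omega\subset\widehat{\mathbb{C}}$ is spherically convex if for any two points $a,b\in\Omega$ that are not antipodal the spherical geodesic joining $a$ and $b$ lies in $\Omega$. A meromorphic univalent (injective) map $f:\mathbb{D}\to\widehat{\mathbb{C}}$ is called spherically convex if $f(\mathbb{D})$ is a spherically convex domain. The spherical derivative is $f^{\sharp}(z)=\frac{|f'(z)|}{1+|f(z)|^2}$. A spherically convex function $f$ is centrally normalized if $$f(z)=\alpha z+a_3z^3+\cdots,\quad z\in\mathbb{D},\qquad\text{where }\alpha=\max_{z\in\mathbb{D}}(1-|z|^2)f^{\sharp}(z)$$ (in particular $f(0)=0$ and $f''(0)=0$). The group of (meromorphic) spherical isometries is $$\mathrm{Rot}(\widehat{\mathbb{C}})=\left\{e^{i\theta}\frac{z-a}{1+z\overline{a}}: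 a\in\mathbb{C},\theta\in\mathbb{R}\right\}\cup\left\{\frac{e^{i\theta}}{z}:\theta\in\mathbb{R}\right\};$$ "$f$ is a spherical isometry" means that $f$ is the restriction to $\mathbb{D}$ of an element of $\mathrm{Rot}(\widehat{\mathbb{C}})$. Spherical lengths are $$L_s f(r\mathbb{T})=\int_{r\mathbb{T}}f^{\sharp}(z)\,|dz|,\qquad L_s(r\mathbb{T})=\int_{r\mathbb{T}}\frac{|dz|}{1+|z|^2}=\frac{2\pi r}{1+r^2}.$$ *)

theory Defs
  imports "HOL-Complex_Analysis.Complex_Analysis"
begin

text \<open>
  The Riemann sphere is \<^typ>\<open>complex option\<close>, with \<^term>\<open>None\<close> the point at infinity; its
  topology is \<^term>\<open>Alexandroff_compactification (euclidean :: complex topology)\<close>.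
\<close>

type_synonym riemann_sphere = "complex option"

text \<open>
  Inverse of the stereographic projection, onto the unit sphere of \<open>complex \<times> real\<close> (Euclidean
  3-space). The induced metric is \<open>2 |dz| / (1 + |z|^2)\<close>, twice the metric \<open>|dz| / (1 + |z|^2)\<close>
  of curvature 4; antipodal points and geodesics are the same for both.
\<close>

definition stereo :: "riemann_sphere \<Rightarrow> complex \<times> real" where
  "stereo p = (case p of
       None \<Rightarrow> (0, 1)
     | Some w \<Rightarrow> (of_real (2 / (1 + (cmod w)\<^sup>2)) * w, ((cmod w)\<^sup>2 - 1) / (1 + (cmod w)\<^sup>2)))"

definition antipodal :: "riemann_sphere \<Rightarrow> riemann_sphere \<Rightarrow> bool" where
  "antipodal a b \<longleftrightarrow> stereo b = - stereo a"

text \<open>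
  For an orthonormal pair \<open>u\<close>, \<open>v\<close>, the curve \<open>t \<mapsto> cos t *\<^sub>R u + sin t *\<^sub>R v\<close> is the unit speed
  parametrization of a great circle. The smaller arc from \<open>a\<close> to \<open>b\<close> is the one of angular length
  \<open>\<theta> < pi\<close>. It is \<open>{a}\<close> if \<open>a = b\<close>; the set below is empty for antipodal points, to which it
  is never applied.
\<close>

definition spherical_geodesic :: "riemann_sphere \<Rightarrow> riemann_sphere \<Rightarrow> riemann_sphere set" where
  "spherical_geodesic a b =
     {c. \<exists>u v \<theta> t. norm u = 1 \<and> norm v = 1 \<and> u \<bullet> v = 0 \<and> 0 \<le> \<theta> \<and> \<theta> < pi
          \<and> stereo a = u \<and> stereo b = cos \<theta> *\<^sub>R u + sin \<theta> *\<^sub>R v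
          \<and> 0 \<le> t \<and> t \<le> \<theta> \<and> stereo c = cos t *\<^sub>R u + sin t *\<^sub>R v}"

definition spherical_domain :: "riemann_sphere set \<Rightarrow> bool" where
  "spherical_domain \<Omega> \<longleftrightarrow> \<Omega> \<noteq> {}
     \<and> openin (Alexandroff_compactification euclidean) \<Omega>
     \<and> connectedin (Alexandroff_compactification euclidean) \<Omega>"

definition spherically_convex_domain :: "riemann_sphere set \<Rightarrow> bool" where
  "spherically_convex_domain \<Omega> \<longleftrightarrow> spherical_domain \<Omega>
     \<and> (\<forall>a\<in>\<Omega>. \<forall>b\<in>\<Omega>. \<not> antipodal a b \<longrightarrow> spherical_geodesic a b \<subseteq> \<Omega>)"

text \<open>
  The complex-valued representative of a sphere-valued map, with value 0 at the poles, as in the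
  library's \<^const>\<open>nicely_meromorphic_on\<close>. Only the values of the map on a neighbourhood of \<open>z\<close>
  matter for poles and derivatives at \<open>z\<close>.
\<close>

definition affine_part :: "('a \<Rightarrow> riemann_sphere) \<Rightarrow> 'a \<Rightarrow> complex" where
  "affine_part f z = (case f z of None \<Rightarrow> 0 | Some w \<Rightarrow> w)"

definition meromorphic_map_on :: "(complex \<Rightarrow> riemann_sphere) \<Rightarrow> complex set \<Rightarrow> bool" where
  "meromorphic_map_on f A \<longleftrightarrow>
     affine_part f nicely_meromorphic_on A \<and> (\<forall>z\<in>A. f z = None \<longleftrightarrow> is_pole (affine_part f) z)"

definition spherically_convex_function :: "(complex \<Rightarrow> riemann_sphere) \<Rightarrow> bool" where
  "spherically_convex_function f \<longleftrightarrow>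
     meromorphic_map_on f (ball 0 1) \<and> inj_on f (ball 0 1)
     \<and> spherically_convex_domain (f ` ball 0 1)"

text \<open>
  At a pole the spherical derivative is that of \<open>1 / f\<close>, since \<open>w \<mapsto> 1 / w\<close> is a spherical
  isometry. There \<open>inverse (affine_part f z) = inverse 0 = 0\<close>, so \<open>\<lambda>w. inverse (affine_part f w)\<close> is
  holomorphic near \<open>z\<close>.
\<close>

definition spherical_deriv :: "(complex \<Rightarrow> riemann_sphere) \<Rightarrow> complex \<Rightarrow> real" where
  "spherical_deriv f z = (case f z of
       Some w \<Rightarrow> cmod (deriv (affine_part f) z) / (1 + (cmod w)\<^sup>2)
     | None \<Rightarrow> cmod (deriv (\<lambda>w. inverse (affine_part f w)) z))"

text \<open>
  The expansion \<open>f(z) = \<alpha> z + a\<^sub>3 z\<^sup>3 + \<dots>\<close> is the Taylor expansion at 0; it holds on the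
  whole disk as soon as \<open>f\<close> has no pole there.
\<close>

definition centrally_normalized :: "(complex \<Rightarrow> riemann_sphere) \<Rightarrow> bool" where
  "centrally_normalized f \<longleftrightarrow>
     f 0 = Some 0
     \<and> (\<exists>(\<alpha>::real) P. affine_part f has_fps_expansion P
           \<and> fps_nth P 0 = 0 \<and> fps_nth P 1 = of_real \<alpha> \<and> fps_nth P 2 = 0
           \<and> (\<exists>z\<in>ball 0 1. \<alpha> = (1 - (cmod z)\<^sup>2) * spherical_deriv f z)
           \<and> (\<forall>z\<in>ball 0 1. (1 - (cmod z)\<^sup>2) * spherical_deriv f z \<le> \<alpha>))"

text \<open>The map \<open>z \<mapsto> (a z + b) / (c z + d)\<close> of the sphere, for \<open>a d - b c \<noteq> 0\<close>.\<close>

definition moebius_map ::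
    "complex \<Rightarrow> complex \<Rightarrow> complex \<Rightarrow> complex \<Rightarrow> riemann_sphere \<Rightarrow> riemann_sphere" where
  "moebius_map a b c d p = (case p of
       None \<Rightarrow> (if c = 0 then None else Some (a / c))
     | Some z \<Rightarrow> (if c * z + d = 0 then None else Some ((a * z + b) / (c * z + d))))"

definition Rot :: "(riemann_sphere \<Rightarrow> riemann_sphere) set" where
  "Rot = {moebius_map (cis \<theta>) (- (cis \<theta> * a)) (cnj a) 1 | a \<theta>. True}
       \<union> {moebius_map 0 (cis \<theta>) 1 0 | \<theta>. True}"

definition spherical_isometry :: "(complex \<Rightarrow> riemann_sphere) \<Rightarrow> bool" where
  "spherical_isometry f \<longleftrightarrow> (\<exists>R\<in>Rot. \<forall>z\<in>ball 0 1. f z = R (Some z))"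

text \<open>The arc length integral of \<open>g\<close> over the circle of radius \<open>r\<close> about 0.\<close>

definition circle_integral :: "real \<Rightarrow> (complex \<Rightarrow> real) \<Rightarrow> real" where
  "circle_integral r g = integral {0..2 * pi} (\<lambda>t. g (of_real r * cis t) * r)"

definition spherical_length_image :: "(complex \<Rightarrow> riemann_sphere) \<Rightarrow> real \<Rightarrow> real" where
  "spherical_length_image f r = circle_integral r (spherical_deriv f)"

definition spherical_length_circle :: "real \<Rightarrow> real" where
  "spherical_length_circle r = circle_integral r (\<lambda>z. 1 / (1 + (cmod z)\<^sup>2))"

lemma spherical_length_circle_eq:
  "spherical_length_circle r = 2 * pi * r / (1 + r\<^sup>2)"
  by (simp add: spherical_length_circle_def circle_integral_def norm_mult)

definition spherical_length_ratio :: "(complex \<Rightarrow> riemann_sphere) \<Rightarrow> real \<Rightarrow> real" where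
  "spherical_length_ratio f r = spherical_length_image f r / spherical_length_circle r"

end

theory Submission
  imports Defs
begin

text \<open>
  Since 0 is a value of \<open>f\<close>, infinity is not: a spherically convex set containing both is
  the whole sphere (\<open>spherically_convex_function_no_pole\<close>). So \<open>f\<close> is a holomorphic function \<open>g\<close>. Put
  \<open>\<phi> = (g')\<^bsup>-1/2\<^esup>\<close> and \<open>\<psi> = g \<phi>\<close>; then the spherical derivative is \<open>1 / N\<close> with \<open>N = |\<phi>|\<^sup>2 + |\<psi>|\<^sup>2\<close>, and
  the length ratio at \<open>r\<close> is the mean of \<open>F = (1 + |z|\<^sup>2) / N\<close> over the circle of radius \<open>r\<close>.

  The function \<open>F\<close> need not be subharmonic, but it nearly is. In logarithmic polar coordinates
  \<open>z = exp (x + i t)\<close>, the Liouville equation for the spherical metric yields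
  \<open>F_xx + F_tt + c F_x = F (8 |\<kappa>|\<^sup>2 - 4 |z|\<^sup>2 V / ((1 - |z|\<^sup>2) N))\<close> with \<open>c = 8 |z|\<^sup>2 / (1 - |z|\<^sup>4)\<close>, a
  logarithmic gradient \<open>\<kappa>\<close>, and a function \<open>V\<close> called the defect below
  (\<open>liouville_quotient_identity\<close>). If \<open>V \<le> 0\<close>, then the mean \<open>M\<close> of \<open>F\<close> satisfies \<open>M'' + c M' \<ge> 0\<close>. The
  first-order term changes nothing: \<open>M'\<close> times an integrating factor is nondecreasing, and it
  cannot be negative because \<open>M\<close> stays bounded at the centre of the disc
  (\<open>mean_monotone_of_subsolution\<close>). If \<open>M'\<close> vanishes at some radius, then \<open>\<kappa> = V = 0\<close> on a disc; this
  forces \<open>N = 1 + |z|\<^sup>2\<close> there, and \<open>g\<close> is a rotation about 0 (\<open>rigidity_of_equality\<close>).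

  It remains to see why \<open>V \<le> 0\<close>. Let \<open>\<rho> = (1 - |z|\<^sup>2) / N\<close>, and let \<open>A\<close> be half the quotient of the second and
  the first derivative at 0 of \<open>g\<close> after a disc automorphism moving 0 to \<open>z\<close> and a rotation moving
  \<open>g z\<close> to 0. Then \<open>V = (|A|\<^sup>2 - 1) / \<rho> + \<rho>\<close>, so that \<open>V \<le> 0\<close> is the sharp inequality
  \<open>|A|\<^sup>2 \<le> 1 - \<rho>\<^sup>2\<close>. Three facts prove it. Seen from any of its points a spherically convex set
  is convex in the plane (\<open>convex_rotated_spherically_convex\<close>), so the classical bound for convex
  functions gives \<open>|A| \<le> 1\<close>, that is, \<open>V \<le> \<rho>\<close>. At the boundary \<open>\<rho>\<close> tends to 0
  (\<open>univalent_convex_bounded_decay\<close>). Finally \<open>V\<close> is a difference of squared moduli of holomorphic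
  functions that turns out to be subharmonic (\<open>defect_fun_max_principle\<close>), so the maximum
  principle applies.
\<close>

section \<open>Geodesics as cones in Euclidean 3-space\<close>

text \<open>
  A unit vector that is a nonnegative combination of two others, not antipodal, lies on the smaller
  great-circle arc between them. This turns spherical convexity into convexity of cones in
  3-space, where everything below becomes linear algebra.
  In the orthonormal frame \<open>u\<close>, \<open>v\<close> of the arc, \<open>x\<close> is the point at angle \<open>arccos k\<close>, where
  \<open>k = s + t c\<close> and \<open>c\<close> is the cosine of the length of the arc; the point to check is \<open>c \<le> k\<close>, so
  that \<open>x\<close> does not lie beyond \<open>w\<close>.
\<close>

lemma arc_of_cone_combination:
  fixes u w x :: "complex \<times> real"
  assumes u: "norm u = 1" and w: "norm w = 1" and x: "norm x = 1" and wu: "w \<noteq> - u"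
    and st: "s \<ge> 0" "t \<ge> 0" and comb: "x = s *\<^sub>R u + t *\<^sub>R w"
  shows "\<exists>v \<theta> \<tau>. norm v = 1 \<and> u \<bullet> v = 0 \<and> 0 \<le> \<theta> \<and> \<theta> < pi
           \<and> w = cos \<theta> *\<^sub>R u + sin \<theta> *\<^sub>R v \<and> 0 \<le> \<tau> \<and> \<tau> \<le> \<theta> \<and> x = cos \<tau> *\<^sub>R u + sin \<tau> *\<^sub>R v"
proof (cases "w = u")
  case True
  obtain y :: "complex \<times> real" where y: "y \<noteq> 0" "orthogonal u y"
    using orthogonal_to_vector_exists[of u] by auto
  define v where "v = y /\<^sub>R norm y"
  have v: "norm v = 1" "u \<bullet> v = 0"
    using y by (auto simp: v_def orthogonal_def)
  have x': "x = (s + t) *\<^sub>R u" using comb True by (simp add: scaleR_left_distrib)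
  then have "s + t = 1" using x u st by simp
  then show ?thesis
    using v True x' by (intro exI[of _ v] exI[of _ 0]) auto
next
  case False
  define c where "c = u \<bullet> w"
  have uu: "u \<bullet> u = 1" and ww: "w \<bullet> w = 1" and xx: "x \<bullet> x = 1"
    using u w x by (simp_all add: norm_eq_1)
  have "(norm (w - u))\<^sup>2 > 0" "(norm (w + u))\<^sup>2 > 0"
    using False wu by (auto simp: add_eq_0_iff2)
  then have c1: "c < 1" "- 1 < c"
    unfolding power2_norm_eq_inner c_def
    by (auto simp: inner_add_left inner_add_right inner_diff_left inner_diff_right uu ww
        inner_commute)
  then have cc: "c\<^sup>2 < 1" by (simp add: abs_square_less_1)
  define S where "S = sqrt (1 - c\<^sup>2)"
  have S: "S > 0" "S\<^sup>2 = 1 - c\<^sup>2" using cc by (auto simp: S_def)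
  define v where "v = (w - c *\<^sub>R u) /\<^sub>R S"
  have wv: "w = c *\<^sub>R u + S *\<^sub>R v" using S by (simp add: v_def)
  have uv: "u \<bullet> v = 0" by (simp add: v_def inner_diff_right uu c_def)
  have "(w - c *\<^sub>R u) \<bullet> (w - c *\<^sub>R u) = S\<^sup>2"
    unfolding S by (simp add: inner_diff_left inner_diff_right uu ww c_def inner_commute power2_eq_square)
  then have "v \<bullet> v = inverse S * (inverse S * S\<^sup>2)"
    by (simp add: v_def)
  then have "v \<bullet> v = 1"
    using S(1) by (simp add: power2_eq_square field_simps)
  then have v: "norm v = 1" by (simp add: norm_eq_1)
  define k where "k = s + t * c"
  have xv: "x = k *\<^sub>R u + (t * S) *\<^sub>R v"
    unfolding comb k_def by (subst (1) wv) (simp add: algebra_simps)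
  have k2: "k\<^sup>2 + (t * S)\<^sup>2 = 1"
    using xx unfolding xv
    by (simp add: inner_add_left inner_add_right uu uv \<open>v \<bullet> v = 1\<close> inner_commute power2_eq_square)
  have kc: "k \<ge> c"
  proof (cases "t \<le> 1")
    case True
    have "(t * S)\<^sup>2 \<le> S\<^sup>2"
      using True st mult_right_mono[of "t\<^sup>2" 1 "S\<^sup>2"] power_le_one[of t 2]
      by (simp only: power_mult_distrib) auto
    then have kk: "c\<^sup>2 \<le> k\<^sup>2" using k2 S by linarith
    show ?thesis
    proof (cases "c \<le> 0")
      case True
      have "t * c \<ge> 1 * c" using True \<open>t \<le> 1\<close> by (intro mult_right_mono_neg) auto
      then show ?thesis using st by (simp add: k_def)
    next
      case False
      then have "k \<ge> 0" using st by (simp add: k_def)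
      then show ?thesis using kk by (rule power2_le_imp_le[rotated])
    qed
  next
    case False
    have "S\<^sup>2 \<le> (t * S)\<^sup>2"
      using False mult_right_mono[of 1 "t\<^sup>2" "S\<^sup>2"] one_le_power[of t 2]
      by (simp only: power_mult_distrib) auto
    then have "k\<^sup>2 \<le> c\<^sup>2" using k2 S by linarith
    then have kk: "\<bar>k\<bar> \<le> \<bar>c\<bar>" by (simp add: abs_le_square_iff)
    show ?thesis
    proof (cases "c \<le> 0")
      case True
      then show ?thesis using kk by linarith
    next
      case c: False
      have "1 * c \<le> t * c" using c False by (intro mult_right_mono) auto
      then show ?thesis using st by (simp add: k_def)
    qed
  qed
  have "k\<^sup>2 \<le> 1" using k2 by (smt (verit) zero_le_power2)
  then have k1: "- 1 \<le> k" "k \<le> 1" using abs_square_le_1[of k] by auto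
  have "sin (arccos k) = t * S"
    using k1 k2 st S by (simp add: sin_arccos) (metis add_diff_cancel_left' mult_nonneg_nonneg
        order_less_imp_le real_sqrt_unique)
  moreover have "sin (arccos c) = S" using c1 by (simp add: sin_arccos S_def)
  moreover have "arccos k \<le> arccos c" using kc k1 c1 by (intro arccos_le_mono[THEN iffD2]) auto
  moreover have "arccos c < pi" using c1 by (simp add: arccos_lt_bounded)
  ultimately show ?thesis
    using v uv wv xv c1 k1
    by (intro exI[of _ v] exI[of _ "arccos c"] exI[of _ "arccos k"])
       (auto simp: arccos_lbound)
qed

text \<open>
  The image of \<open>w\<close> under stereographic projection up to a positive factor, namely
  \<open>1 + |w|\<^sup>2\<close>, which is also its norm. Being polynomial in \<open>w\<close>, it is the convenient generator of
  the ray through that point.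
\<close>

definition sphere_ray :: "complex \<Rightarrow> complex \<times> real" where
  "sphere_ray w = (2 * w, (cmod w)\<^sup>2 - 1)"

lemma stereo_Some: "stereo (Some w) = sphere_ray w /\<^sub>R (1 + (cmod w)\<^sup>2)"
  by (simp add: stereo_def sphere_ray_def divide_inverse scaleR_conv_of_real)

lemma cmod_diff_sq: "(cmod (a - b))\<^sup>2 = (cmod a)\<^sup>2 + (cmod b)\<^sup>2 - 2 * (a \<bullet> b)"
  by (simp add: power2_norm_eq_inner inner_diff_left inner_diff_right inner_commute)

lemma inner_sphere_ray:
  "sphere_ray a \<bullet> sphere_ray b = (1 + (cmod a)\<^sup>2) * (1 + (cmod b)\<^sup>2) - 2 * (cmod (a - b))\<^sup>2"
proof -
  have "2 * a = 2 *\<^sub>R a" "2 * b = 2 *\<^sub>R b" by (simp_all add: scaleR_conv_of_real)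
  then have "(2 * a) \<bullet> (2 * b) = 4 * (a \<bullet> b)" by simp
  then show ?thesis
    by (simp add: sphere_ray_def cmod_diff_sq algebra_simps)
qed

lemma norm_sphere_ray: "norm (sphere_ray w) = 1 + (cmod w)\<^sup>2"
  by (simp add: norm_eq_sqrt_inner inner_sphere_ray)

lemma norm_stereo: "norm (stereo p) = 1"
proof (cases p)
  case (Some w)
  have "1 + (cmod w)\<^sup>2 > 0" by (simp add: add_pos_nonneg)
  then show ?thesis by (simp add: Some stereo_Some norm_sphere_ray)
qed (simp add: stereo_def)

text \<open>
  After division by the right-hand side this is Thales' theorem: the summands become the squared
  chordal distances from \<open>a\<close> to \<open>b\<close> and to the antipode of \<open>b\<close>, relative to the diameter.
\<close>

lemma cmod_chordal_identity:
  "(cmod (a - b))\<^sup>2 + (cmod (1 + cnj b * a))\<^sup>2 = (1 + (cmod a)\<^sup>2) * (1 + (cmod b)\<^sup>2)"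
  unfolding cmod_power2 by (simp add: power2_eq_square algebra_simps)

lemma one_plus_cmod_sq_pos: "1 + (cmod w)\<^sup>2 > 0"
  by (simp add: add_pos_nonneg)

lemma antipodal_Some:
  assumes "antipodal (Some a) (Some b)"
  shows "1 + cnj b * a = 0"
proof -
  define A B where "A = 1 + (cmod a)\<^sup>2" and "B = 1 + (cmod b)\<^sup>2"
  have pos: "A > 0" "B > 0" by (simp_all add: A_def B_def one_plus_cmod_sq_pos)
  have "stereo (Some a) \<bullet> stereo (Some b) = - (stereo (Some a) \<bullet> stereo (Some a))"
    using assms unfolding antipodal_def by simp
  also have "\<dots> = - 1" using norm_stereo[of "Some a"] by (simp add: norm_eq_1)
  finally have "inverse A * (inverse B * (sphere_ray a \<bullet> sphere_ray b)) = - 1"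
    by (simp add: stereo_Some A_def B_def mult.left_commute)
  then have "sphere_ray a \<bullet> sphere_ray b = - (A * B)"
    using pos by (simp add: field_simps)
  then have "(cmod (a - b))\<^sup>2 = A * B" by (simp add: inner_sphere_ray A_def B_def)
  then show ?thesis using cmod_chordal_identity[of a b] by (simp add: A_def B_def)
qed

lemma stereo_surj:
  assumes "norm x = 1"
  shows "\<exists>p. stereo p = x"
proof -
  obtain z y where xy: "x = (z, y)" by (cases x)
  have n: "(cmod z)\<^sup>2 + y\<^sup>2 = 1" using assms by (simp add: xy norm_Pair)
  show ?thesis
  proof (cases "y = 1")
    case True
    then have "z = 0" using n by simp
    then show ?thesis using True xy by (intro exI[of _ None]) (simp add: stereo_def)
  next
    case False
    have "y\<^sup>2 \<le> 1" using n by (smt (verit) zero_le_power2)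
    then have y: "y < 1" using False abs_square_le_1[of y] by auto
    define w where "w = z /\<^sub>R (1 - y)"
    have "(cmod w)\<^sup>2 = (cmod z)\<^sup>2 / (1 - y)\<^sup>2"
      using y by (simp add: w_def divide_inverse power_mult_distrib power_inverse)
    also have "\<dots> = (1 - y\<^sup>2) / (1 - y)\<^sup>2"
      using n by (simp add: eq_diff_eq)
    also have "\<dots> = (1 + y) / (1 - y)"
      using y by (simp add: power2_eq_square divide_simps) (simp add: algebra_simps)
    finally have w2: "(cmod w)\<^sup>2 = (1 + y) / (1 - y)" .
    have "1 + (cmod w)\<^sup>2 = 2 / (1 - y)" "(cmod w)\<^sup>2 - 1 = 2 * y / (1 - y)"
      unfolding w2 using y by (simp_all add: field_simps)
    then have "stereo (Some w) = (z, y)"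
      using y by (simp add: stereo_Some sphere_ray_def w_def scaleR_conv_of_real)
    then show ?thesis using xy by blast
  qed
qed

lemma geodesic_of_cone_combination:
  assumes "\<not> antipodal a b" "s \<ge> 0" "t \<ge> 0" "stereo p = s *\<^sub>R stereo a + t *\<^sub>R stereo b"
  shows "p \<in> spherical_geodesic a b"
  using arc_of_cone_combination[OF norm_stereo[of a] norm_stereo[of b] norm_stereo[of p] _ assms(2-4)]
    assms(1) norm_stereo[of a]
  unfolding antipodal_def spherical_geodesic_def by blast

lemma spherically_convex_cone2:
  assumes "spherically_convex_domain \<Omega>" "a \<in> \<Omega>" "b \<in> \<Omega>" "\<not> antipodal a b"
    and "s \<ge> 0" "t \<ge> 0" "stereo p = s *\<^sub>R stereo a + t *\<^sub>R stereo b"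
  shows "p \<in> \<Omega>"
  using assms geodesic_of_cone_combination unfolding spherically_convex_domain_def by blast

lemma spherically_convex_ray2:
  assumes "spherically_convex_domain \<Omega>" "Some a \<in> \<Omega>" "Some b \<in> \<Omega>" "1 + cnj b * a \<noteq> 0"
    and "s \<ge> 0" "t \<ge> 0" "k > 0" "k *\<^sub>R stereo p = s *\<^sub>R sphere_ray a + t *\<^sub>R sphere_ray b"
  shows "p \<in> \<Omega>"
proof (rule spherically_convex_cone2[OF assms(1-3)])
  show "\<not> antipodal (Some a) (Some b)" using assms(4) antipodal_Some by blast
  have eq: "sphere_ray w = (1 + (cmod w)\<^sup>2) *\<^sub>R stereo (Some w)" for w
    using one_plus_cmod_sq_pos[of w] by (simp add: stereo_Some)
  have "stereo p = (1 / k) *\<^sub>R (k *\<^sub>R stereo p)" using assms(7) by simp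
  also have "\<dots> = (s * (1 + (cmod a)\<^sup>2) / k) *\<^sub>R stereo (Some a)
                + (t * (1 + (cmod b)\<^sup>2) / k) *\<^sub>R stereo (Some b)"
    unfolding assms(8) by (simp add: eq scaleR_right_distrib)
  finally show "stereo p = (s * (1 + (cmod a)\<^sup>2) / k) *\<^sub>R stereo (Some a)
                + (t * (1 + (cmod b)\<^sup>2) / k) *\<^sub>R stereo (Some b)" .
qed (use assms one_plus_cmod_sq_pos in \<open>auto intro!: divide_nonneg_pos mult_nonneg_nonneg\<close>)


lemma open_of_spherically_convex:
  assumes "spherically_convex_domain (Some ` S)"
  shows "open S"
  using assms unfolding spherically_convex_domain_def spherical_domain_def by simp

section \<open>Spherically convex subsets of the plane\<close>

text \<open>
  If \<open>b\<close> is the antipode of \<open>a\<close>, push \<open>a\<close> slightly outwards along its ray to \<open>w\<close>, still in the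
  open set \<open>S\<close>. Then \<open>b\<close> and \<open>w\<close> lie on a great circle through 0 and infinity, and the smaller
  arc between them is the one through infinity, which is not a point of \<open>S\<close>.
\<close>

lemma spherically_convex_no_antipodal:
  assumes conv: "spherically_convex_domain (Some ` S)" and a: "a \<in> S" and b: "b \<in> S"
  shows "1 + cnj b * a \<noteq> 0"
proof
  assume ab: "1 + cnj b * a = 0"
  then have a0: "a \<noteq> 0" by auto
  obtain e where e: "e > 0" "ball a e \<subseteq> S"
    using open_of_spherically_convex[OF conv] a open_contains_ball by blast
  define d where "d = e / (2 * cmod a)"
  define w where "w = (1 + d) *\<^sub>R a"
  have d: "d > 0" using e a0 by (simp add: d_def)
  have "dist a w = d * cmod a" using d by (simp add: w_def dist_norm scaleR_left_distrib)
  also have "\<dots> < e" using e a0 by (simp add: d_def)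
  finally have wS: "w \<in> S" using e by auto
  have bw: "1 + cnj w * b \<noteq> 0"
  proof -
    have "cnj w * b = (1 + d) *\<^sub>R cnj (cnj b * a)" by (simp add: w_def)
    also have "cnj b * a = - 1" using ab by (simp add: add_eq_0_iff)
    finally have "1 + cnj w * b = of_real (- d)" by (simp add: scaleR_conv_of_real)
    then show ?thesis using d by simp
  qed
  have beq: "b = - (a /\<^sub>R (cmod a)\<^sup>2)"
  proof -
    have "cnj a * b = - 1"
      using arg_cong[OF ab, of cnj] by (simp add: add_eq_0_iff mult.commute)
    then have "a * (cnj a * b) = - a" by simp
    then have "of_real ((cmod a)\<^sup>2) * b = - a"
      by (simp only: complex_norm_square mult.assoc)
    then show ?thesis using a0 by (simp add: scaleR_conv_of_real field_simps)
  qed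
  define s where "s = (1 + d) * (cmod a)\<^sup>2"
  define k where "k = d + (1 + d) * d * (cmod a)\<^sup>2"
  have b2: "(cmod b)\<^sup>2 = inverse ((cmod a)\<^sup>2)"
    using a0 by (simp add: beq power2_eq_square)
  have w2: "(cmod w)\<^sup>2 = (1 + d)\<^sup>2 * (cmod a)\<^sup>2"
    by (simp add: w_def power_mult_distrib)
  have "None \<in> Some ` S"
  proof (rule spherically_convex_ray2[OF conv _ _ bw])
    show "k > 0" using d by (simp add: k_def add_pos_nonneg)
    show "s \<ge> 0" using d by (simp add: s_def)
    have "s *\<^sub>R (2 * b) + 1 *\<^sub>R (2 * w) = 0"
      using a0 by (simp add: s_def beq w_def scaleR_conv_of_real)
    moreover have "s * ((cmod b)\<^sup>2 - 1) + ((cmod w)\<^sup>2 - 1) = k"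
      using a0 unfolding b2 w2 s_def k_def
      by (simp add: field_simps) (simp add: algebra_simps power2_eq_square)
    ultimately show "k *\<^sub>R stereo None = s *\<^sub>R sphere_ray b + 1 *\<^sub>R sphere_ray w"
      by (simp add: stereo_def sphere_ray_def)
  qed (use wS b in auto)
  then show False by auto
qed

text \<open>
  The cone over a spherically convex set is closed under combinations of three rays: combine the
  first two to a point of the set, then that point with the third.
\<close>

lemma spherically_convex_ray3:
  assumes conv: "spherically_convex_domain (Some ` S)" and S: "a \<in> S" "b \<in> S" "c \<in> S"
    and nn: "x \<ge> 0" "y \<ge> 0" "z \<ge> 0" and k: "k > 0"
    and eq: "k *\<^sub>R stereo p = x *\<^sub>R sphere_ray a + y *\<^sub>R sphere_ray b + z *\<^sub>R sphere_ray c"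
  shows "p \<in> Some ` S"
proof -
  define u where "u = x *\<^sub>R sphere_ray a + y *\<^sub>R sphere_ray b"
  show ?thesis
  proof (cases "u = 0")
    case True
    show ?thesis
      using spherically_convex_ray2[OF conv _ _ spherically_convex_no_antipodal[OF conv S(3) S(3)],
          of z 0 k p] S nn k eq True
      by (simp add: u_def)
  next
    case False
    obtain q where q: "stereo q = u /\<^sub>R norm u"
      using stereo_surj[of "u /\<^sub>R norm u"] False by auto
    have "q \<in> Some ` S"
      by (rule spherically_convex_ray2[OF conv _ _ spherically_convex_no_antipodal[OF conv S(1) S(2)],
            of x y "norm u"]) (use S nn False q u_def in auto)
    then obtain q' where q': "q = Some q'" "q' \<in> S" by auto
    have "u = norm u *\<^sub>R stereo q" using q False by simp
    then have "u = (norm u / (1 + (cmod q')\<^sup>2)) *\<^sub>R sphere_ray q'"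
      by (simp add: q' stereo_Some divide_inverse)
    then have "k *\<^sub>R stereo p
        = (norm u / (1 + (cmod q')\<^sup>2)) *\<^sub>R sphere_ray q' + z *\<^sub>R sphere_ray c"
      using eq u_def by simp
    then show ?thesis
      using spherically_convex_ray2[OF conv _ _ spherically_convex_no_antipodal[OF conv q'(2) S(3)],
          of "norm u / (1 + (cmod q')\<^sup>2)" z k p] S q' nn k one_plus_cmod_sq_pos[of q']
      by simp
  qed
qed

section \<open>Rotations and Euclidean convexity\<close>

text \<open>
  A rotation of the sphere carrying \<open>c\<close> to 0. It acts linearly on 3-space, but its matrix never
  appears: \<open>inner_sphere_ray_rotate\<close> says that Gram matrices of rays are preserved
  up to the scaling below, and a Gram matrix determines which linear combinations vanish
  (\<open>combination_eq_0_gram\<close>).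
\<close>

definition rotate_to_0 :: "complex \<Rightarrow> complex \<Rightarrow> complex" where
  "rotate_to_0 c w = (w - c) / (1 + cnj c * w)"

definition rotation_scale :: "complex \<Rightarrow> complex \<Rightarrow> real" where
  "rotation_scale c w = (cmod (1 + cnj c * w))\<^sup>2 / (1 + (cmod c)\<^sup>2)"

lemma rotation_scale_pos: "1 + cnj c * w \<noteq> 0 \<Longrightarrow> rotation_scale c w > 0"
  by (simp add: rotation_scale_def one_plus_cmod_sq_pos)

lemma rotate_to_0_diff:
  assumes "1 + cnj c * a \<noteq> 0" "1 + cnj c * b \<noteq> 0"
  shows "rotate_to_0 c a - rotate_to_0 c b
           = (a - b) * of_real (1 + (cmod c)\<^sup>2) / ((1 + cnj c * a) * (1 + cnj c * b))"
proof -
  have "of_real (1 + (cmod c)\<^sup>2) = 1 + c * cnj c" by (simp flip: complex_norm_square)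
  then show ?thesis
    using assms unfolding rotate_to_0_def by (simp only:) (simp add: field_simps)
qed

lemma one_plus_cmod_sq_rotate:
  assumes "1 + cnj c * a \<noteq> 0"
  shows "rotation_scale c a * (1 + (cmod (rotate_to_0 c a))\<^sup>2) = 1 + (cmod a)\<^sup>2"
proof -
  have "(cmod (rotate_to_0 c a))\<^sup>2 = (cmod (a - c))\<^sup>2 / (cmod (1 + cnj c * a))\<^sup>2"
    by (simp add: rotate_to_0_def norm_divide power_divide)
  then have "1 + (cmod (rotate_to_0 c a))\<^sup>2
      = ((cmod (a - c))\<^sup>2 + (cmod (1 + cnj c * a))\<^sup>2) / (cmod (1 + cnj c * a))\<^sup>2"
    using assms by (simp add: field_simps)
  also have "\<dots> = (1 + (cmod a)\<^sup>2) * (1 + (cmod c)\<^sup>2) / (cmod (1 + cnj c * a))\<^sup>2"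
    by (simp only: cmod_chordal_identity)
  finally show ?thesis
    using assms one_plus_cmod_sq_pos[of c] by (simp add: rotation_scale_def)
qed

lemma inner_sphere_ray_rotate:
  assumes "1 + cnj c * a \<noteq> 0" "1 + cnj c * b \<noteq> 0"
  shows "sphere_ray a \<bullet> sphere_ray b = rotation_scale c a * rotation_scale c b
           * (sphere_ray (rotate_to_0 c a) \<bullet> sphere_ray (rotate_to_0 c b))"
proof -
  have "rotation_scale c a * rotation_scale c b * (cmod (rotate_to_0 c a - rotate_to_0 c b))\<^sup>2
      = (cmod (a - b))\<^sup>2"
  proof -
    define C where "C = 1 + (cmod c)\<^sup>2"
    have C: "C > 0" by (simp add: C_def one_plus_cmod_sq_pos)
    have "cmod (of_real C) = C" using C by simp
    then show ?thesis
      using assms C unfolding rotate_to_0_diff[OF assms] rotation_scale_def C_def[symmetric]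
      by (simp add: norm_divide norm_mult power_mult_distrib power_divide) (simp add: power2_eq_square)
  qed
  then show ?thesis
    unfolding inner_sphere_ray one_plus_cmod_sq_rotate[OF assms(1), symmetric]
      one_plus_cmod_sq_rotate[OF assms(2), symmetric]
    by (simp add: algebra_simps)
qed

lemma sphere_ray_scaled_inj:
  assumes "k > 0" "sphere_ray w = k *\<^sub>R sphere_ray m"
  shows "w = m"
proof -
  have "2 * w = k *\<^sub>R (2 * m)" and 1: "(cmod w)\<^sup>2 - 1 = k * ((cmod m)\<^sup>2 - 1)"
    using assms(2) by (simp_all add: sphere_ray_def)
  then have 2: "w = k *\<^sub>R m" by (simp add: scaleR_conv_of_real)
  have "norm (sphere_ray w) = k * norm (sphere_ray m)" using assms by simp
  then have "k = 1" using 1 by (simp add: norm_sphere_ray algebra_simps)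
  then show ?thesis using 2 by simp
qed

text \<open>
  Both sides of the claim differ by a vector whose norm is computed by the Gram matrix, hence
  equals the norm of the corresponding, vanishing, difference of the \<open>x\<close>'s.
\<close>

lemma combination_eq_0_gram:
  fixes x0 x1 x2 x3 :: "'a::real_inner" and y0 y1 y2 y3 :: "'b::real_inner"
  assumes "x0 = r *\<^sub>R x1 + s *\<^sub>R x2 + t *\<^sub>R x3"
    and "x0 \<bullet> x0 = y0 \<bullet> y0" "x0 \<bullet> x1 = y0 \<bullet> y1" "x0 \<bullet> x2 = y0 \<bullet> y2" "x0 \<bullet> x3 = y0 \<bullet> y3"
    and "x1 \<bullet> x1 = y1 \<bullet> y1" "x1 \<bullet> x2 = y1 \<bullet> y2" "x1 \<bullet> x3 = y1 \<bullet> y3"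
    and "x2 \<bullet> x2 = y2 \<bullet> y2" "x2 \<bullet> x3 = y2 \<bullet> y3" "x3 \<bullet> x3 = y3 \<bullet> y3"
  shows "y0 = r *\<^sub>R y1 + s *\<^sub>R y2 + t *\<^sub>R y3"
proof -
  have "(y0 - (r *\<^sub>R y1 + s *\<^sub>R y2 + t *\<^sub>R y3)) \<bullet> (y0 - (r *\<^sub>R y1 + s *\<^sub>R y2 + t *\<^sub>R y3))
      = (x0 - (r *\<^sub>R x1 + s *\<^sub>R x2 + t *\<^sub>R x3)) \<bullet> (x0 - (r *\<^sub>R x1 + s *\<^sub>R x2 + t *\<^sub>R x3))"
    using assms(2-)
    by (simp only: inner_add_left inner_add_right inner_diff_left inner_diff_right
        inner_scaleR_left inner_scaleR_right inner_commute[of x1 x0] inner_commute[of x2 x0]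
        inner_commute[of x3 x0] inner_commute[of x2 x1] inner_commute[of x3 x1] inner_commute[of x3 x2]
        inner_commute[of y1 y0] inner_commute[of y2 y0] inner_commute[of y3 y0]
        inner_commute[of y2 y1] inner_commute[of y3 y1] inner_commute[of y3 y2])
  also have "\<dots> = 0" using assms(1) by simp
  finally show ?thesis by simp
qed


text \<open>
  Seen from one of its points, placed at 0, a spherically convex set is convex in the plane.
  The great-circle arc between two points bulges away from 0 compared with the Euclidean segment,
  so the segment lies in the spherical triangle with the third vertex 0. In terms of rays: for a
  convex combination \<open>m\<close> of \<open>a'\<close> and \<open>b'\<close>, the ray of \<open>m\<close> is the same combination of the rays of
  \<open>a'\<close> and \<open>b'\<close> plus the multiple \<open>d = u v |a' - b'|\<^sup>2\<close> of the ray of 0, and \<open>d \<ge> 0\<close>.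
\<close>

lemma convex_rotated_spherically_convex:
  assumes conv: "spherically_convex_domain (Some ` S)" and c: "c \<in> S"
  shows "convex (rotate_to_0 c ` S)"
proof -
  have nz: "1 + cnj c * a \<noteq> 0" if "a \<in> S" for a
    using spherically_convex_no_antipodal[OF conv that c] .
  define y where "y a = sphere_ray a /\<^sub>R rotation_scale c a" for a
  define x where "x a = sphere_ray (rotate_to_0 c a)" for a
  have kpos: "rotation_scale c a > 0" if "a \<in> S" for a
    using rotation_scale_pos nz that by blast
  have gram: "y a \<bullet> y b = x a \<bullet> x b" if "a \<in> S" "b \<in> S" for a b
    using kpos[OF that(1)] kpos[OF that(2)] inner_sphere_ray_rotate[OF nz nz, OF that]
    by (simp add: y_def x_def field_simps)
  have "u *\<^sub>R rotate_to_0 c a + v *\<^sub>R rotate_to_0 c b \<in> rotate_to_0 c ` S"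
    if ab: "a \<in> S" "b \<in> S" and uv: "u \<ge> 0" "v \<ge> 0" "u + v = 1" for a b u v
  proof -
    define a' b' where "a' = rotate_to_0 c a" and "b' = rotate_to_0 c b"
    define m where "m = u *\<^sub>R a' + v *\<^sub>R b'"
    define d where "d = u * v * (cmod (a' - b'))\<^sup>2"
    have d: "d \<ge> 0" using uv by (simp add: d_def)
    have u': "u = 1 - v" using uv by simp
    have "d = u * (cmod a')\<^sup>2 + v * (cmod b')\<^sup>2 - (cmod m)\<^sup>2"
      unfolding d_def m_def u' power2_norm_eq_inner
      by (simp add: inner_add_left inner_add_right inner_diff_left inner_diff_right
          inner_commute[of b' a'] algebra_simps)
    then have "(cmod m)\<^sup>2 - 1 = u * ((cmod a')\<^sup>2 - 1) + v * ((cmod b')\<^sup>2 - 1) - d"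
      unfolding u' by (simp add: algebra_simps)
    moreover have "2 * m = u *\<^sub>R (2 * a') + v *\<^sub>R (2 * b')"
      by (simp add: m_def algebra_simps)
    ultimately have raym: "sphere_ray m = u *\<^sub>R x a + v *\<^sub>R x b + d *\<^sub>R x c"
      by (simp add: sphere_ray_def x_def a'_def[symmetric] b'_def[symmetric])
         (simp add: rotate_to_0_def)
    \<comment> \<open>the combination before the rotation; it spans the ray of a point \<open>q\<close> of \<open>S\<close>, which the rotation takes to \<open>m\<close>\<close>
    define w where "w = u *\<^sub>R y a + v *\<^sub>R y b + d *\<^sub>R y c"
    have wy: "w \<bullet> y e = sphere_ray m \<bullet> x e" if "e \<in> S" for e
      unfolding w_def raym by (simp add: inner_add_left gram ab c that)
    have w0: "w \<noteq> 0"
    proof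
      assume w0: "w = 0"
      have "0 = u *\<^sub>R x a + v *\<^sub>R x b + d *\<^sub>R x c"
        by (rule combination_eq_0_gram[where ?x0.0 = 0 and ?x1.0 = "y a" and ?x2.0 = "y b" and ?x3.0 = "y c"])
           (use w0 in \<open>simp_all add: gram ab c w_def\<close>)
      then have "norm (sphere_ray m) = 0" using raym by simp
      then show False using one_plus_cmod_sq_pos[of m] by (simp only: norm_sphere_ray)
    qed
    obtain p where p: "stereo p = w /\<^sub>R norm w"
      using stereo_surj[of "w /\<^sub>R norm w"] w0 by auto
    have "p \<in> Some ` S"
    proof (rule spherically_convex_ray3[OF conv ab c])
      show "norm w *\<^sub>R stereo p = (u / rotation_scale c a) *\<^sub>R sphere_ray a
          + (v / rotation_scale c b) *\<^sub>R sphere_ray b + (d / rotation_scale c c) *\<^sub>R sphere_ray c"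
        using w0 by (simp add: p) (simp add: w_def y_def divide_inverse)
    qed (use uv d w0 kpos ab c in \<open>auto intro!: divide_nonneg_pos\<close>)
    then obtain q where q: "p = Some q" "q \<in> S" by auto
    define k where "k = norm w * rotation_scale c q / (1 + (cmod q)\<^sup>2)"
    have k: "k > 0" using w0 kpos[OF q(2)] one_plus_cmod_sq_pos[of q] by (simp add: k_def)
    have wq: "w = k *\<^sub>R y q"
    proof -
      have "w = norm w *\<^sub>R stereo p" using p w0 by simp
      moreover have "k * inverse (rotation_scale c q) = norm w * inverse (1 + (cmod q)\<^sup>2)"
        using kpos[OF q(2)] by (simp add: k_def divide_inverse)
      ultimately show ?thesis by (simp add: q stereo_Some y_def)
    qed
    have "k *\<^sub>R x q = u *\<^sub>R x a + v *\<^sub>R x b + d *\<^sub>R x c"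
      by (rule combination_eq_0_gram[where ?x0.0 = "k *\<^sub>R y q" and ?x1.0 = "y a" and ?x2.0 = "y b" and ?x3.0 = "y c"])
         (use wq in \<open>simp_all add: gram ab c q w_def\<close>)
    then have "sphere_ray m = k *\<^sub>R sphere_ray (rotate_to_0 c q)"
      by (simp add: raym x_def)
    then have "m = rotate_to_0 c q" by (rule sphere_ray_scaled_inj[OF k])
    then show ?thesis using q by (auto simp: m_def a'_def b'_def)
  qed
  then show ?thesis by (auto simp: convex_def)
qed

lemma convex_spherically_convex_0:
  assumes "spherically_convex_domain (Some ` S)" "0 \<in> S"
  shows "convex S"
proof -
  have "rotate_to_0 0 = (\<lambda>w. w)" by (simp add: rotate_to_0_def fun_eq_iff)
  then show ?thesis using convex_rotated_spherically_convex[OF assms] by simp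
qed

text \<open>
  A disc around 0 lies in \<open>S\<close>, and \<open>S\<close> avoids the antipodes of its points, which fill a
  neighbourhood of infinity.
\<close>

lemma bounded_spherically_convex_0:
  assumes conv: "spherically_convex_domain (Some ` S)" and "0 \<in> S"
  shows "bounded S"
proof -
  obtain e where e: "e > 0" "ball 0 e \<subseteq> S"
    using open_of_spherically_convex[OF conv] assms(2) open_contains_ball by blast
  have "cmod a \<le> 1 / e" if a: "a \<in> S" for a
  proof (rule ccontr)
    assume "\<not> cmod a \<le> 1 / e"
    then have gt: "cmod a > 1 / e" by simp
    then have "cmod a > 0" using e by (smt (verit) zero_less_divide_1_iff)
    then have a0: "a \<noteq> 0" "1 / cmod a < e" using gt e by (auto simp: field_simps)
    define b where "b = - (1 / cnj a)"
    have "b \<in> S" using a0 e by (auto simp: b_def norm_divide)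
    moreover have "1 + cnj b * a = 0" using a0 by (simp add: b_def)
    ultimately show False using spherically_convex_no_antipodal[OF conv a] by blast
  qed
  then show ?thesis by (auto simp: bounded_iff)
qed

text \<open>
  All far points \<open>t w\<close> belong to the set, and every \<open>w\<close> lies on the geodesic from 0 to some \<open>t w\<close>.
\<close>

lemma spherically_convex_0_infinity:
  assumes conv: "spherically_convex_domain \<Omega>" and "Some 0 \<in> \<Omega>" "None \<in> \<Omega>"
  shows "\<Omega> = UNIV"
proof -
  have "openin (Alexandroff_compactification euclidean) \<Omega>"
    using conv unfolding spherically_convex_domain_def spherical_domain_def by blast
  then obtain C where C: "compact C" "\<Omega> = insert None (Some ` (- C))"
    using assms(3) unfolding openin_Alexandroff_compactification
    by (auto simp: Compl_eq_Diff_UNIV)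
  obtain B where B: "\<And>z. z \<in> C \<Longrightarrow> cmod z \<le> B"
    using C(1) compact_imp_bounded bounded_iff by metis
  have "Some w \<in> \<Omega>" for w
  proof (cases "w = 0")
    case False
    define t where "t = 1 + \<bar>B\<bar> / cmod w"
    have t: "t \<ge> 1" by (simp add: t_def)
    have "cmod (t *\<^sub>R w) = cmod w + \<bar>B\<bar>"
      using False t by (simp add: t_def field_simps)
    then have "t *\<^sub>R w \<notin> C" using B[of "t *\<^sub>R w"] False by (smt (verit) zero_less_norm_iff)
    then have tw: "Some (t *\<^sub>R w) \<in> \<Omega>" by (simp add: C(2))
    show ?thesis
    proof (rule spherically_convex_ray2[OF conv assms(2) tw])
      define s where "s = (t - 1) * (cmod w)\<^sup>2 + (1 - 1 / t)"
      show "s \<ge> 0" using t by (simp add: s_def)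
      have "(cmod w)\<^sup>2 - 1 = s * (- 1) + (1 / t) * ((cmod (t *\<^sub>R w))\<^sup>2 - 1)"
        using t by (simp add: s_def power_mult_distrib power2_eq_square field_simps)
      moreover have "(1 + (cmod w)\<^sup>2) *\<^sub>R stereo (Some w) = sphere_ray w"
        using one_plus_cmod_sq_pos[of w] by (simp add: stereo_Some)
      ultimately show "(1 + (cmod w)\<^sup>2) *\<^sub>R stereo (Some w)
          = s *\<^sub>R sphere_ray 0 + (1 / t) *\<^sub>R sphere_ray (t *\<^sub>R w)"
        using t by (simp add: sphere_ray_def scaleR_conv_of_real)
      show "1 / t \<ge> 0" using t by simp
      show "1 + (cmod w)\<^sup>2 > 0" by (rule one_plus_cmod_sq_pos)
    qed simp
  qed (use assms in simp)
  moreover have "None \<in> \<Omega>" by fact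
  ultimately show ?thesis by (metis UNIV_eq_I not_None_eq)
qed

text \<open>
  A pole \<open>z\<close> would put infinity into the image, next to 0, so that the image would be the whole
  sphere. Then the inverse of \<open>f\<close>, restricted to the plane, is a bounded entire function, which
  contradicts Liouville's theorem.
\<close>

lemma spherically_convex_function_no_pole:
  assumes f: "spherically_convex_function f" and f0: "f 0 = Some 0" and z: "z \<in> ball 0 1"
  shows "f z \<noteq> None"
proof
  assume fz: "f z = None"
  have mer: "meromorphic_map_on f (ball 0 1)" and inj: "inj_on f (ball 0 1)"
    and conv: "spherically_convex_domain (f ` ball 0 1)"
    using f unfolding spherically_convex_function_def by auto
  have all: "f ` ball 0 1 = UNIV"
    by (rule spherically_convex_0_infinity[OF conv])
       (use f0[symmetric] fz[symmetric] z in \<open>auto intro!: image_eqI\<close>)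
  define U where "U = ball (0::complex) 1 - {z}"
  have some: "f w = Some (affine_part f w)" if "w \<in> U" for w
  proof -
    have "f w \<noteq> None" using that inj fz z by (metis DiffE U_def inj_onD insert_iff)
    then show ?thesis by (auto simp: affine_part_def)
  qed
  have hol: "affine_part f holomorphic_on U"
  proof -
    have "affine_part f analytic_on {w}" if "w \<in> U" for w
    proof (rule nicely_meromorphic_on_imp_analytic_at)
      show "affine_part f nicely_meromorphic_on ball 0 1" "w \<in> ball 0 1"
        using mer that by (auto simp: meromorphic_map_on_def U_def)
      show "\<not> is_pole (affine_part f) w"
        using mer that some[OF that] unfolding meromorphic_map_on_def U_def
        by (metis DiffE option.distinct(1))
    qed
    then show ?thesis using analytic_imp_holomorphic analytic_on_analytic_at by blast
  qed
  have injU: "inj_on (affine_part f) U"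
    using inj some by (smt (verit) DiffE U_def inj_on_def)
  have imU: "affine_part f ` U = UNIV"
  proof -
    have "w \<in> affine_part f ` U" for w
    proof -
      obtain v where v: "v \<in> ball 0 1" "f v = Some w" using all by (metis UNIV_I imageE)
      then have "v \<in> U" using fz by (auto simp: U_def)
      then show ?thesis using some v by force
    qed
    then show ?thesis by blast
  qed
  have "open U" by (simp add: U_def open_delete)
  from holomorphic_has_inverse[OF hol this injU]
  obtain h where h: "h holomorphic_on UNIV" "\<And>w. w \<in> U \<Longrightarrow> h (affine_part f w) = w"
    unfolding imU by metis
  have "range h \<subseteq> ball 0 1" using h(2) imU U_def by (smt (verit) DiffE UNIV_I image_iff image_subset_iff)
  then have "bounded (range h)" using bounded_ball bounded_subset by blast
  then have "h constant_on UNIV" using Liouville_theorem h(1) by blast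
  then have eq: "v = w" if "v \<in> U" "w \<in> U" for v w
    using h(2) that by (metis UNIV_I constant_on_def)
  have "infinite U" unfolding U_def by (simp add: uncountable_infinite uncountable_ball)
  then obtain v where "v \<in> U" by (metis finite.emptyI ex_in_conv)
  then have "U \<subseteq> {v}" using eq by blast
  then show False using \<open>infinite U\<close> finite_subset by blast
qed

section \<open>The second coefficient\<close>

lemma deriv_unit_disc_bound:
  assumes hol: "h holomorphic_on ball 0 1" and bd: "\<And>z. z \<in> ball 0 1 \<Longrightarrow> cmod (h z) \<le> 1"
  shows "cmod ((deriv ^^ n) h 0) \<le> fact n"
proof (rule field_le_mult_one_interval)
  fix x :: real
  assume x: "0 < x" "x < 1"
  define r where "r = root (Suc n) x"
  have r: "0 < r" "r < 1" using x by (auto simp: r_def)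
  have "r ^ Suc n = x" using x by (simp add: r_def del: power_Suc)
  moreover have "r ^ Suc n \<le> r ^ n" using r by (intro power_decreasing) auto
  ultimately have xr: "x \<le> r ^ n" by simp
  have sub: "cball 0 r \<subseteq> ball (0::complex) 1" using r by auto
  have "cmod ((deriv ^^ n) h 0) \<le> fact n * 1 / r ^ n"
  proof (rule Cauchy_inequality)
    show "h holomorphic_on ball 0 r"
      using hol sub ball_subset_cball holomorphic_on_subset by (metis subset_trans)
    show "continuous_on (cball 0 r) h"
      using hol sub holomorphic_on_imp_continuous_on holomorphic_on_subset by blast
    show "cmod (h x) \<le> 1" if "cmod (0 - x) = r" for x using that r bd by simp
  qed (use r in simp)
  then have "r ^ n * cmod ((deriv ^^ n) h 0) \<le> fact n"
    using r by (simp add: field_simps)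
  then show "x * cmod ((deriv ^^ n) h 0) \<le> fact n"
    using xr by (meson mult_right_mono norm_ge_zero order_trans)
qed

text \<open>
  The midpoint of \<open>G z\<close> and \<open>G (- z)\<close> lies in the convex image, so it equals \<open>G (h z)\<close> for a
  self-map \<open>h\<close> of the disc. In the midpoint the odd coefficients cancel: \<open>h\<close> starts with a
  quadratic term, whose coefficient is the ratio of the first two coefficients of \<open>G\<close>; Cauchy's
  estimate bounds it by 1.
\<close>

lemma convex_univalent_second_derivative:
  assumes hol: "G holomorphic_on ball 0 1" and inj: "inj_on G (ball 0 1)"
    and conv: "convex (G ` ball 0 1)"
  shows "cmod (deriv (deriv G) 0) \<le> 2 * cmod (deriv G 0)"
proof -
  let ?D = "ball (0::complex) 1"
  have G1: "(G has_field_derivative deriv G z) (at z)" if "z \<in> ?D" for z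
    using hol that by (simp add: holomorphic_derivI)
  have G2: "(deriv G has_field_derivative deriv (deriv G) z) (at z)" if "z \<in> ?D" for z
    using holomorphic_deriv[OF hol] that by (simp add: holomorphic_derivI)
  define H where "H z = (G z + G (- z)) / 2" for z
  have Hin: "H z \<in> G ` ?D" if "z \<in> ?D" for z
    using convexD[OF conv, of "G z" "G (- z)" "1/2" "1/2"] that
    by (simp add: H_def scaleR_conv_of_real field_simps)
  have H1: "(H has_field_derivative (deriv G z - deriv G (- z)) / 2) (at z)" if "z \<in> ?D" for z
    unfolding H_def
    by (rule derivative_eq_intros G1[OF that] DERIV_chain2[where f = G and g = uminus, OF G1] | use that in simp)+
  obtain g where g: "g holomorphic_on (G ` ?D)" "\<And>z. z \<in> ?D \<Longrightarrow> g (G z) = z"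
    using holomorphic_has_inverse[OF hol open_ball inj] by metis
  define h where "h z = g (H z)" for z
  have hball: "h z \<in> ?D" and Gh: "G (h z) = H z" if "z \<in> ?D" for z
    using Hin[OF that] g(2) by (auto simp: h_def)
  have "H holomorphic_on ?D" using H1 holomorphic_on_open by blast
  then have "(g \<circ> H) holomorphic_on ?D"
    using Hin g(1) by (intro holomorphic_on_compose_gen) auto
  then have holh: "h holomorphic_on ?D" by (simp add: h_def[abs_def] o_def)
  have h1: "(h has_field_derivative deriv h z) (at z)" if "z \<in> ?D" for z
    using holh that by (simp add: holomorphic_derivI)
  have h2: "(deriv h has_field_derivative deriv (deriv h) z) (at z)" if "z \<in> ?D" for z
    using holomorphic_deriv[OF holh] that by (simp add: holomorphic_derivI)
  have h0: "h 0 = 0" using g(2)[of 0] by (simp add: h_def H_def)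
  have eq1: "deriv G (h z) * deriv h z = (deriv G z - deriv G (- z)) / 2" if z: "z \<in> ?D" for z
  proof -
    have "((\<lambda>z. G (h z)) has_field_derivative deriv G (h z) * deriv h z) (at z)"
      using DERIV_chain2[OF G1 h1] hball z by blast
    moreover have "((\<lambda>z. G (h z)) has_field_derivative (deriv G z - deriv G (- z)) / 2) (at z)"
      by (rule has_field_derivative_transform_within_open[OF H1[OF z], of ?D]) (use z Gh in auto)
    ultimately show ?thesis by (rule DERIV_unique)
  qed
  have G0: "deriv G 0 \<noteq> 0"
    using holomorphic_injective_imp_regular[OF hol _ inj] by simp
  then have dh0: "deriv h 0 = 0" using eq1[of 0] h0 by simp
  have "deriv G 0 * deriv (deriv h) 0 = deriv (deriv G) 0"
  proof (rule DERIV_unique)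
    have "((\<lambda>z. deriv G (h z) * deriv h z) has_field_derivative deriv G 0 * deriv (deriv h) 0) (at 0)"
      by (rule derivative_eq_intros DERIV_chain2[OF G2 h1] h2 | use hball in \<open>simp add: dh0 h0\<close>)+
    then show "((\<lambda>z. (deriv G z - deriv G (- z)) / 2) has_field_derivative deriv G 0 * deriv (deriv h) 0) (at 0)"
      by (rule has_field_derivative_transform_within_open[of _ _ _ ?D]) (use eq1 in auto)
    show "((\<lambda>z. (deriv G z - deriv G (- z)) / 2) has_field_derivative deriv (deriv G) 0) (at 0)"
      by (rule derivative_eq_intros G2 DERIV_chain2[where f = "deriv G" and g = uminus, OF G2] | simp)+
  qed
  moreover have "cmod (deriv (deriv h) 0) \<le> 2"
    using deriv_unit_disc_bound[OF holh, of 2] hball by (simp add: numeral_2_eq_2 less_imp_le)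
  ultimately show ?thesis
    by (metis mult.commute mult_right_mono norm_ge_zero norm_mult)
qed

text \<open>
  The automorphism of the unit disc that moves 0 to \<open>c\<close>.
\<close>

definition disc_shift :: "complex \<Rightarrow> complex \<Rightarrow> complex" where
  "disc_shift c z = (z + c) / (1 + cnj c * z)"

lemma disc_shift_denom:
  assumes "cmod c < 1" "cmod z < 1"
  shows "1 + cnj c * z \<noteq> 0"
proof
  assume "1 + cnj c * z = 0"
  then have "cmod (cnj c * z) = 1" by (metis add_eq_0_iff norm_minus_cancel norm_one)
  moreover have "cmod c * cmod z < 1"
    using assms by (metis mult_strict_mono' norm_ge_zero mult_1)
  ultimately show False by (simp add: norm_mult)
qed

lemma disc_shift_in_ball:
  assumes "c \<in> ball 0 1" "z \<in> ball 0 1"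
  shows "disc_shift c z \<in> ball 0 1"
proof -
  have "(cmod (1 + cnj c * z))\<^sup>2 - (cmod (z + c))\<^sup>2 = (1 - (cmod c)\<^sup>2) * (1 - (cmod z)\<^sup>2)"
    unfolding cmod_power2 by (simp add: power2_eq_square algebra_simps)
  moreover have "(1 - (cmod c)\<^sup>2) * (1 - (cmod z)\<^sup>2) > 0"
    using assms by (simp add: abs_square_less_1)
  ultimately have "(cmod (z + c))\<^sup>2 < (cmod (1 + cnj c * z))\<^sup>2" by linarith
  then have "cmod (z + c) < cmod (1 + cnj c * z)" using power2_less_imp_less by force
  then show ?thesis by (simp add: disc_shift_def norm_divide divide_less_eq_1)
qed

lemma disc_shift_inverse:
  assumes "c \<in> ball 0 1" "z \<in> ball 0 1"
  shows "disc_shift c (disc_shift (- c) z) = z"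
proof -
  have n: "1 - cnj c * z \<noteq> 0" "1 - cnj c * c \<noteq> 0"
    using disc_shift_denom[of "- c"] assms by force+
  have "disc_shift (- c) z + c = z * (1 - cnj c * c) / (1 - cnj c * z)"
    "1 + cnj c * disc_shift (- c) z = (1 - cnj c * c) / (1 - cnj c * z)"
    using n by (simp_all add: disc_shift_def field_simps)
  then show ?thesis using n unfolding disc_shift_def[of c] by simp
qed

lemma disc_shift_image: "c \<in> ball 0 1 \<Longrightarrow> disc_shift c ` ball 0 1 = ball 0 1"
proof (intro equalityI subsetI)
  fix z assume "c \<in> ball 0 1" "z \<in> ball (0::complex) 1"
  then show "z \<in> disc_shift c ` ball 0 1"
    using disc_shift_inverse[of c z] disc_shift_in_ball[of "- c" z] by (metis imageI mem_ball_0 norm_minus_cancel)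
qed (use disc_shift_in_ball in auto)

lemma inj_on_disc_shift: "c \<in> ball 0 1 \<Longrightarrow> inj_on (disc_shift c) (ball 0 1)"
  by (rule inj_on_inverseI[of _ "disc_shift (- c)"]) (use disc_shift_inverse[of "- c"] in auto)

lemma disc_shift_0 [simp]: "disc_shift c 0 = c"
  by (simp add: disc_shift_def)

lemma disc_shift_deriv:
  assumes "c \<in> ball 0 1" "z \<in> ball 0 1"
  shows "(disc_shift c has_field_derivative (1 - c * cnj c) / (1 + cnj c * z)\<^sup>2) (at z)"
proof -
  have n: "1 + cnj c * z \<noteq> 0" using disc_shift_denom assms by simp
  show ?thesis
    unfolding disc_shift_def
    by (rule derivative_eq_intros refl n)+ (simp add: power2_eq_square algebra_simps)
qed

text \<open>
  Precompose \<open>g\<close> with the disc automorphism moving 0 to \<open>z\<close> and compose with the rotation taking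
  \<open>g z\<close> to 0. The result maps onto a convex set, and the quantity inside the norm is half
  the quotient of its second and first derivatives at 0.
\<close>

lemma spherically_convex_second_coefficient:
  assumes hol: "g holomorphic_on ball 0 1" and inj: "inj_on g (ball 0 1)"
    and conv: "spherically_convex_domain (Some ` g ` ball 0 1)" and z: "z \<in> ball 0 1"
  shows "cmod ((1 - (cmod z)\<^sup>2) * (deriv (deriv g) z / (2 * deriv g z)
              - cnj (g z) * deriv g z / (1 + (cmod (g z))\<^sup>2)) - cnj z) \<le> 1"
proof -
  let ?D = "ball (0::complex) 1"
  define c where "c = g z"
  define C where "C = 1 + c * cnj c"
  define d where "d = 1 - z * cnj z"
  have Cr: "C = of_real (1 + (cmod c)\<^sup>2)" by (simp add: C_def complex_norm_square del: of_real_power)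
  have dr: "d = of_real (1 - (cmod z)\<^sup>2)" by (simp add: d_def complex_norm_square del: of_real_power)
  have C0: "C \<noteq> 0" unfolding Cr using one_plus_cmod_sq_pos[of c] by (metis of_real_eq_0_iff less_irrefl)
  have "(cmod z)\<^sup>2 < 1" using z by (simp add: abs_square_less_1)
  then have d0: "d \<noteq> 0" unfolding dr by (metis diff_gt_0_iff_gt of_real_eq_0_iff less_irrefl)
  define g1 g2 where "g1 = deriv g" and "g2 = deriv g1"
  have D1: "(g has_field_derivative g1 w) (at w)" if "w \<in> ?D" for w
    using hol that by (simp add: holomorphic_derivI g1_def)
  have D2: "(g1 has_field_derivative g2 w) (at w)" if "w \<in> ?D" for w
    using holomorphic_deriv[OF hol] that by (simp add: holomorphic_derivI g1_def g2_def)
  have g1z: "g1 z \<noteq> 0"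
    using holomorphic_injective_imp_regular[OF hol _ inj z] by (simp add: g1_def)
  have T0: "1 + cnj c * g w \<noteq> 0" if "w \<in> ?D" for w
    using spherically_convex_no_antipodal[OF conv] that z by (simp add: c_def)
  define b where "b = disc_shift z"
  define b1 where "b1 w = d / (1 + cnj z * w)\<^sup>2" for w
  have b: "b w \<in> ?D" "(b has_field_derivative b1 w) (at w)" if "w \<in> ?D" for w
    using disc_shift_in_ball[OF z that] disc_shift_deriv[OF z that] by (auto simp: b_def b1_def d_def)
  have b1': "(b1 has_field_derivative - 2 * cnj z * d) (at 0)"
    unfolding b1_def by (rule derivative_eq_intros refl | simp)+
  define G where "G w = rotate_to_0 c (g (b w))" for w
  define T1 where "T1 v = C / (1 + cnj c * v)\<^sup>2" for v
  have T: "(rotate_to_0 c has_field_derivative T1 v) (at v)" if "1 + cnj c * v \<noteq> 0" for v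
    unfolding rotate_to_0_def T1_def C_def
    by (rule derivative_eq_intros refl that)+ (simp add: power2_eq_square algebra_simps)
  have cC: "1 + cnj c * c = C" by (simp add: C_def)
  have T': "(T1 has_field_derivative - 2 * cnj c / C\<^sup>2) (at c)"
    unfolding T1_def by (rule derivative_eq_intros refl | simp add: cC C0)+
      (simp add: C0 cC power2_eq_square eval_nat_numeral)
  have G1: "(G has_field_derivative T1 (g (b w)) * (g1 (b w) * b1 w)) (at w)" if "w \<in> ?D" for w
    unfolding G_def
    by (intro DERIV_chain2[OF T] DERIV_chain2[OF D1] b T0) (use b that in auto)
  have G2: "((\<lambda>w. T1 (g (b w)) * (g1 (b w) * b1 w)) has_field_derivative
      (- 2 * cnj c / C\<^sup>2) * (g1 z * d) * (g1 z * d) + ((g2 z * d) * d + (- 2 * cnj z * d) * g1 z) * (1 / C)) (at 0)"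
  proof -
    have b0: "b 0 = z" "b1 0 = d" by (simp_all add: b_def b1_def)
    have e1: "((\<lambda>w. T1 (g (b w))) has_field_derivative (- 2 * cnj c / C\<^sup>2) * (g1 z * d)) (at 0)"
      by (rule DERIV_chain2[where f = T1 and g = "\<lambda>w. g (b w)"], use T' in \<open>simp add: b0 c_def\<close>,
          rule DERIV_chain2[where f = g and g = b])
         (use D1[OF z] b(2)[of 0] in \<open>simp_all add: b0\<close>)
    have e2: "((\<lambda>w. g1 (b w)) has_field_derivative g2 z * d) (at 0)"
      by (rule DERIV_chain2[where f = g1 and g = b])
         (use D2[OF z] b(2)[of 0] in \<open>simp_all add: b0\<close>)
    have "T1 (g (b 0)) = 1 / C" using C0 by (simp add: b0 c_def[symmetric] T1_def cC power2_eq_square)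
    then show ?thesis
      using DERIV_mult[OF e1 DERIV_mult[OF e2 b1']] by (simp add: b0)
  qed
  have holG: "G holomorphic_on ?D" using G1 holomorphic_on_open by blast
  have dG0: "deriv G 0 = g1 z * d / C"
    using DERIV_imp_deriv[OF G1[of 0]] C0
    by (simp add: b_def b1_def c_def[symmetric] T1_def cC power2_eq_square)
  have "deriv (deriv G) 0 = deriv (\<lambda>w. T1 (g (b w)) * (g1 (b w) * b1 w)) 0"
    by (rule deriv_cong_ev) (use DERIV_imp_deriv[OF G1] in \<open>auto simp: eventually_nhds intro!: exI[of _ ?D]\<close>)
  then have ddG0: "deriv (deriv G) 0
      = (- 2 * cnj c / C\<^sup>2) * (g1 z * d) * (g1 z * d) + ((g2 z * d) * d + (- 2 * cnj z * d) * g1 z) * (1 / C)"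
    using DERIV_imp_deriv[OF G2] by simp
  have imG: "G ` ?D = rotate_to_0 c ` g ` ?D"
    unfolding G_def b_def using disc_shift_image[OF z] by (metis (no_types) image_image)
  have injG: "inj_on G ?D"
  proof -
    have "inj_on (rotate_to_0 c) (g ` ?D)"
    proof (rule inj_onI)
      fix u v assume uv: "u \<in> g ` ?D" "v \<in> g ` ?D" "rotate_to_0 c u = rotate_to_0 c v"
      then have n: "1 + cnj c * u \<noteq> 0" "1 + cnj c * v \<noteq> 0" using T0 by auto
      have "complex_of_real (1 + (cmod c)\<^sup>2) \<noteq> 0" using C0 Cr by simp
      then show "u = v" using rotate_to_0_diff[OF n] uv(3) n by simp
    qed
    then have "inj_on (rotate_to_0 c \<circ> (g \<circ> b)) ?D"
      using inj_on_disc_shift[OF z] inj disc_shift_image[OF z]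
      by (intro comp_inj_on) (simp_all add: b_def flip: image_image image_comp)
    then show ?thesis by (simp add: G_def[abs_def] o_def)
  qed
  have "convex (G ` ?D)"
    unfolding imG by (rule convex_rotated_spherically_convex[OF conv]) (use z in \<open>simp add: c_def\<close>)
  from convex_univalent_second_derivative[OF holG injG this]
  have le: "cmod (deriv (deriv G) 0) \<le> cmod (2 * deriv G 0)" by (simp add: norm_mult)
  define A where "A = d * (g2 z / (2 * g1 z) - cnj c * g1 z / C) - cnj z"
  have "deriv (deriv G) 0 = (2 * deriv G 0) * A"
    unfolding ddG0 dG0 A_def using C0 g1z by (simp add: field_simps power2_eq_square)
  then have "cmod (2 * deriv G 0) * cmod A \<le> cmod (2 * deriv G 0) * 1"
    using le by (simp add: norm_mult)
  moreover have "cmod (2 * deriv G 0) > 0" using dG0 g1z d0 C0 by simp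
  ultimately have "cmod A \<le> 1" by (meson mult_le_cancel_left_pos)
  then show ?thesis unfolding A_def g1_def g2_def c_def[symmetric] Cr dr by simp
qed

section \<open>Decay at the boundary\<close>

text \<open>
  A line through \<open>w\<close> separates \<open>w\<close> from the convex image, so \<open>g\<close> maps into a half-plane. After a
  Cayley transform of the half-plane and a disc automorphism, this is the Schwarz lemma at 0.
\<close>

lemma univalent_convex_distance:
  assumes hol: "g holomorphic_on ball 0 1" and op: "open (g ` ball 0 1)"
    and conv: "convex (g ` ball 0 1)" and z: "z \<in> ball 0 1" and w: "w \<notin> g ` ball 0 1"
  shows "(1 - (cmod z)\<^sup>2) * cmod (deriv g z) \<le> 2 * cmod (g z - w)"
proof -
  let ?D = "ball (0::complex) 1"
  obtain a b where a: "a \<noteq> 0" "a \<bullet> w \<le> b" "\<And>x. x \<in> g ` ?D \<Longrightarrow> a \<bullet> x \<ge> b"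
  proof -
    have "g ` ?D \<noteq> {}" using z by blast
    from separating_hyperplane_set_point_inaff[OF conv this w] that show ?thesis by metis
  qed
  define p where "p v = cnj a * (g v - w)" for v
  have Rep: "Re (p v) = a \<bullet> g v - a \<bullet> w" for v
    by (simp add: p_def inner_complex_def algebra_simps)
  have pnn: "Re (p v) \<ge> 0" if "v \<in> ?D" for v
    using a(2) a(3)[of "g v"] that by (simp add: Rep)
  have ppos: "Re (p z) > 0"
  proof -
    obtain e where e: "e > 0" "ball (g z) e \<subseteq> g ` ?D"
      using op z open_contains_ball by blast
    define t where "t = e / (2 * norm a)"
    have t: "t > 0" "t * norm a < e" using e a(1) by (auto simp: t_def)
    then have "g z - t *\<^sub>R a \<in> g ` ?D" using e by (auto simp: dist_norm)
    then have "a \<bullet> (g z - t *\<^sub>R a) \<ge> b" using a(3) by blast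
    moreover have "t * (a \<bullet> a) > 0" using t a(1) by simp
    ultimately show ?thesis using a(2) by (simp add: Rep inner_diff_right)
  qed
  define P where "P = p z"
  define k where "k v = (p (disc_shift z v) - P) / (p (disc_shift z v) + cnj P)" for v
  have kd: "p (disc_shift z v) + cnj P \<noteq> 0" if "v \<in> ?D" for v
  proof -
    have "Re (p (disc_shift z v) + cnj P) > 0"
      using pnn[OF disc_shift_in_ball[OF z that]] ppos by (simp add: P_def)
    then show ?thesis by (metis less_irrefl zero_complex.sel(1))
  qed
  define d where "d = 1 - z * cnj z"
  have pd: "((\<lambda>v. p (disc_shift z v)) has_field_derivative
      cnj a * (deriv g (disc_shift z v) * (d / (1 + cnj z * v)\<^sup>2))) (at v)" if "v \<in> ?D" for v
  proof -
    have "((\<lambda>v. g (disc_shift z v)) has_field_derivative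
        deriv g (disc_shift z v) * (d / (1 + cnj z * v)\<^sup>2)) (at v)"
      using DERIV_chain2[OF holomorphic_derivI[OF hol open_ball disc_shift_in_ball[OF z that]]
          disc_shift_deriv[OF z that]] by (simp add: d_def)
    then show ?thesis unfolding p_def by (auto intro!: derivative_eq_intros)
  qed
  have kder: "(k has_field_derivative
      (cnj a * (deriv g (disc_shift z v) * (d / (1 + cnj z * v)\<^sup>2))) * (P + cnj P)
        / (p (disc_shift z v) + cnj P)\<^sup>2) (at v)" if "v \<in> ?D" for v
  proof -
    have gen: "((\<lambda>v. (Q v - P) / (Q v + cnj P)) has_field_derivative
        X * (P + cnj P) / (Q v + cnj P)\<^sup>2) (at v)"
      if "(Q has_field_derivative X) (at v)" "Q v + cnj P \<noteq> 0" for Q X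
      by (rule derivative_eq_intros that refl)+ (simp add: power2_eq_square algebra_simps)
    show ?thesis unfolding k_def by (rule gen[OF pd[OF that] kd[OF that]])
  qed
  have holk: "k holomorphic_on ?D" using kder holomorphic_on_open by blast
  have "cmod (k v) \<le> 1" if "v \<in> ?D" for v
  proof -
    let ?q = "p (disc_shift z v)"
    have "(cmod (?q + cnj P))\<^sup>2 - (cmod (?q - P))\<^sup>2 = 4 * Re ?q * Re P"
      unfolding cmod_power2 by (simp add: power2_eq_square algebra_simps)
    moreover have "4 * Re ?q * Re P \<ge> 0"
      using pnn[OF disc_shift_in_ball[OF z that]] ppos by (simp add: P_def)
    ultimately have "(cmod (?q - P))\<^sup>2 \<le> (cmod (?q + cnj P))\<^sup>2" by linarith
    then have "cmod (?q - P) \<le> cmod (?q + cnj P)" by (rule power2_le_imp_le) simp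
    then show ?thesis using kd[OF that] by (simp add: k_def norm_divide divide_le_eq_1)
  qed
  then have k1: "cmod (deriv k 0) \<le> 1"
    using deriv_unit_disc_bound[OF holk, of 1] by simp
  have kd0: "deriv k 0 = cnj a * (deriv g z * d) / (P + cnj P)"
    using DERIV_imp_deriv[OF kder[of 0]] kd[of 0] by (simp add: P_def[symmetric] power2_eq_square)
  have PP: "cmod (P + cnj P) = 2 * Re P"
    using ppos by (simp only: complex_add_cnj norm_of_real) (simp add: P_def)
  have dr: "d = of_real (1 - (cmod z)\<^sup>2)"
    by (simp add: d_def complex_norm_square del: of_real_power)
  have "(cmod z)\<^sup>2 < 1" using z by (simp add: abs_square_less_1)
  then have dn: "cmod d = 1 - (cmod z)\<^sup>2" by (simp only: dr norm_of_real)
  have "cmod a * (cmod (deriv g z) * (1 - (cmod z)\<^sup>2)) / (2 * Re P) \<le> 1"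
    using k1 by (simp only: kd0 norm_divide norm_mult dn PP complex_mod_cnj)
  then have "cmod a * (cmod (deriv g z) * (1 - (cmod z)\<^sup>2)) \<le> 2 * Re P"
    using ppos by (simp add: P_def field_simps)
  also have "Re P \<le> cmod a * cmod (g z - w)"
    using complex_Re_le_cmod[of P] by (simp add: P_def p_def norm_mult)
  finally have "cmod a * (cmod (deriv g z) * (1 - (cmod z)\<^sup>2)) \<le> cmod a * (2 * cmod (g z - w))"
    by simp
  then show ?thesis using a(1) by (simp add: mult.commute)
qed

text \<open>
  The points of the image at distance at least \<open>e / 2\<close> from the complement form a compact
  set, whose preimage stays away from the unit circle. All other points are close to the
  complement, where \<open>univalent_convex_distance\<close> applies.
\<close>

lemma univalent_convex_bounded_decay:
  assumes hol: "g holomorphic_on ball 0 1" and inj: "inj_on g (ball 0 1)"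
    and conv: "convex (g ` ball 0 1)" and bd: "bounded (g ` ball 0 1)" and e: "e > 0"
  shows "\<exists>R<1. \<forall>z. R \<le> cmod z \<longrightarrow> cmod z < 1 \<longrightarrow> (1 - (cmod z)\<^sup>2) * cmod (deriv g z) < e"
proof -
  let ?D = "ball (0::complex) 1"
  define S where "S = g ` ?D"
  have op: "open S" unfolding S_def using open_mapping_thm3[OF hol _ inj] by simp
  have "S \<noteq> UNIV" using bd not_bounded_UNIV unfolding S_def by metis
  then have ne: "- S \<noteq> {}" by blast
  define K where "K = {w. infdist w (- S) \<ge> e / 2}"
  have KS: "K \<subseteq> S"
  proof
    fix w assume "w \<in> K"
    then show "w \<in> S" using e infdist_zero[of w "- S"] unfolding K_def by (cases "w \<in> S") auto
  qed
  have "closed K" unfolding K_def by (intro closed_Collect_le continuous_intros)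
  moreover have "bounded K" using KS bd bounded_subset S_def by blast
  ultimately have cK: "compact K" by (simp add: compact_eq_bounded_closed)
  obtain h where h: "h holomorphic_on S" "\<And>z. z \<in> ?D \<Longrightarrow> h (g z) = z"
    using holomorphic_has_inverse[OF hol open_ball inj] unfolding S_def by metis
  have hK: "compact (h ` K)"
    by (rule compact_continuous_image[OF continuous_on_subset[OF holomorphic_on_imp_continuous_on[OF h(1)] KS] cK])
  have hD: "h ` K \<subseteq> ?D" using KS h(2) by (auto simp: S_def)
  obtain R where R: "R < 1" "\<And>z. z \<in> h ` K \<Longrightarrow> cmod z < R"
  proof (cases "h ` K = {}")
    case True
    then show ?thesis using that[of 0] by auto
  next
    case False
    obtain x where x: "x \<in> h ` K" "\<And>y. y \<in> h ` K \<Longrightarrow> cmod y \<le> cmod x"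
      using continuous_attains_sup[OF hK False, of cmod] continuous_on_norm_id by metis
    have "cmod x < 1" using x(1) hD by auto
    then show ?thesis using that[of "(cmod x + 1) / 2"] x(2) by fastforce
  qed
  have "(1 - (cmod z)\<^sup>2) * cmod (deriv g z) < e" if z: "R \<le> cmod z" "cmod z < 1" for z
  proof -
    have "g z \<notin> K"
    proof
      assume "g z \<in> K"
      then have "h (g z) \<in> h ` K" by blast
      then show False using h(2)[of z] R(2) z by force
    qed
    then have "infdist (g z) (- S) < e / 2" by (simp add: K_def)
    then obtain w where w: "w \<in> - S" "dist (g z) w < e / 2"
      unfolding infdist_notempty[OF ne] using ne by (subst (asm) cInf_less_iff) auto
    have "(1 - (cmod z)\<^sup>2) * cmod (deriv g z) \<le> 2 * cmod (g z - w)"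
      by (rule univalent_convex_distance[OF hol _ conv]) (use op w z in \<open>auto simp: S_def\<close>)
    then show ?thesis using w(2) by (simp add: dist_norm)
  qed
  then show ?thesis using R(1) by (intro exI[of _ R]) simp
qed

section \<open>A maximum principle\<close>

lemma second_deriv_nonpos_at_local_max:
  fixes u :: "real \<Rightarrow> real"
  assumes d: "d > 0" and u1: "\<And>t. \<bar>t\<bar> < d \<Longrightarrow> (u has_real_derivative u' t) (at t)"
    and u2: "(u' has_real_derivative c) (at 0)" and mx: "\<And>t. \<bar>t\<bar> < d \<Longrightarrow> u t \<le> u 0"
  shows "c \<le> 0"
proof (rule ccontr)
  assume "\<not> c \<le> 0"
  then obtain e where e: "e > 0" "\<And>h. h > 0 \<Longrightarrow> h < e \<Longrightarrow> u' 0 < u' h"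
    using DERIV_pos_inc_right[OF u2] by auto
  have "u' 0 = 0"
    by (rule DERIV_local_max[OF u1[of 0] d]) (use d mx in auto)
  define s where "s = min d e / 2"
  have s: "0 < s" "s < d" "s < e" using d e by (auto simp: s_def)
  obtain \<xi> where x: "0 < \<xi>" "\<xi> < s" "u s - u 0 = (s - 0) * u' \<xi>"
    using MVT2[OF s(1), of u u'] u1 s by force
  then have "u s - u 0 > 0" using e(2)[of \<xi>] s \<open>u' 0 = 0\<close> by simp
  then show False using mx[of s] s by simp
qed

lemma has_real_derivative_inner:
  assumes "(f has_vector_derivative f') (at t within S)" "(g has_vector_derivative g') (at t within S)"
  shows "((\<lambda>t. f t \<bullet> g t) has_real_derivative (f t \<bullet> g' + f' \<bullet> g t)) (at t within S)"
  using bounded_bilinear.has_vector_derivative[OF bounded_bilinear_inner assms]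
  by (simp add: has_real_derivative_iff_has_vector_derivative)

lemma has_vector_derivative_along_line:
  assumes w: "z + of_real t * e = w" and F: "(F has_field_derivative F') (at w)"
  shows "((\<lambda>t. F (z + of_real t * e)) has_vector_derivative e * F') (at t)"
proof -
  have "((\<lambda>t. z + of_real t * e) has_vector_derivative e) (at t)"
    by (auto intro!: derivative_eq_intros)
  from field_vector_diff_chain_at[where g = F, OF this, of F'] w F show ?thesis by (simp add: o_def)
qed

lemma square_norm_along_line:
  assumes w: "z + of_real t * e = w" and F: "(F has_field_derivative F') (at w)"
  shows "((\<lambda>t. (cmod (F (z + of_real t * e)))\<^sup>2) has_real_derivative 2 * (F w \<bullet> (e * F'))) (at t)"
  using has_real_derivative_inner[OF has_vector_derivative_along_line[OF w F]
      has_vector_derivative_along_line[OF w F]] w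
  by (simp add: power2_norm_eq_inner inner_commute)

lemma square_norm_along_line2:
  assumes w: "z + of_real t * e = w" and F: "(F has_field_derivative G w) (at w)"
    and G: "(G has_field_derivative G') (at w)"
  shows "((\<lambda>t. 2 * (F (z + of_real t * e) \<bullet> (e * G (z + of_real t * e)))) has_real_derivative
            2 * (F w \<bullet> (e * e * G')) + 2 * (cmod (e * G w))\<^sup>2) (at t)"
proof -
  have "((\<lambda>t. e * G (z + of_real t * e)) has_vector_derivative e * (e * G')) (at t)"
    using has_vector_derivative_along_line[OF w G] by (auto intro!: derivative_eq_intros)
  from has_real_derivative_inner[OF has_vector_derivative_along_line[OF w F] this] w
  show ?thesis
    by (auto intro!: derivative_eq_intros simp: power2_norm_eq_inner mult.assoc)
qed

text \<open>
  For \<open>\<phi> = (g')\<^bsup>-1/2\<^esup>\<close> and \<open>\<psi> = g \<phi>\<close> this is \<open>V = (|A|\<^sup>2 - 1) / \<rho> + \<rho>\<close>, where \<open>\<rho>\<close> is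
  \<open>(1 - |z|\<^sup>2)\<close> times the spherical derivative of \<open>g\<close> and \<open>A\<close> is the quantity bounded in
  \<open>spherically_convex_second_coefficient\<close>. So \<open>V \<le> 0\<close> is the sharp bound \<open>|A|\<^sup>2 \<le> 1 - \<rho>\<^sup>2\<close> for
  spherically convex functions. It is written as a difference of squared moduli of holomorphic
  functions because that form shows its subharmonicity.
\<close>

definition defect_fun :: "(complex \<Rightarrow> complex) \<Rightarrow> (complex \<Rightarrow> complex) \<Rightarrow> complex \<Rightarrow> real" where
  "defect_fun \<phi> \<psi> z = (cmod (deriv \<phi> z))\<^sup>2 + (cmod (deriv \<psi> z))\<^sup>2
     - (cmod (z * deriv \<phi> z - \<phi> z))\<^sup>2 - (cmod (z * deriv \<psi> z - \<psi> z))\<^sup>2"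

text \<open>
  The Laplacian of \<open>|F|\<^sup>2\<close> is \<open>4 |F'|\<^sup>2\<close>, and the derivative of \<open>z \<phi>' - \<phi>\<close> is \<open>z \<phi>''\<close>. So the
  Laplacian of the defect is \<open>4 (1 - |z|\<^sup>2) (|\<phi>''|\<^sup>2 + |\<psi>''|\<^sup>2) \<ge> 0\<close>, whatever \<open>\<phi>\<close> and \<open>\<psi>\<close> are, and
  the maximum principle for subharmonic functions applies.
\<close>

lemma defect_fun_max_principle:
  assumes hol: "\<phi> holomorphic_on ball 0 1" "\<psi> holomorphic_on ball 0 1"
    and bdry: "\<And>e. e > 0 \<Longrightarrow> \<exists>R<1. \<forall>z. R \<le> cmod z \<longrightarrow> cmod z < 1 \<longrightarrow> defect_fun \<phi> \<psi> z \<le> e"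
    and z0: "z0 \<in> ball 0 1"
  shows "defect_fun \<phi> \<psi> z0 \<le> 0"
proof (rule ccontr)
  let ?D = "ball (0::complex) 1"
  let ?V = "defect_fun \<phi> \<psi>"
  assume "\<not> ?V z0 \<le> 0"
  then have v: "?V z0 > 0" by simp
  define e where "e = ?V z0 / 4"
  have e: "e > 0" using v by (simp add: e_def)
  obtain R where R: "R < 1" "\<And>z. R \<le> cmod z \<Longrightarrow> cmod z < 1 \<Longrightarrow> ?V z \<le> e"
    using bdry[OF e] by blast
  \<comment> \<open>perturbing by \<open>e |z|\<^sup>2\<close> makes the Laplacian strictly positive, so that the second-derivative test at an interior maximum gives a contradiction\<close>
  define W where "W z = ?V z + e * (cmod z)\<^sup>2" for z
  define R' where "R' = max R (cmod z0)"
  have R': "R' < 1" "cmod z0 \<le> R'" "R \<le> R'" using R z0 by (auto simp: R'_def)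
  have sub: "cball 0 R' \<subseteq> ?D" using R' by auto
  have "continuous_on ?D W"
    unfolding W_def defect_fun_def
    by (intro continuous_intros holomorphic_on_imp_continuous_on holomorphic_deriv hol open_ball)
  then have "continuous_on (cball 0 R') W" using sub continuous_on_subset by blast
  moreover have "z0 \<in> cball 0 R'" using R'(2) by simp
  then have "cball (0::complex) R' \<noteq> {}" by blast
  ultimately obtain m where m: "m \<in> cball 0 R'" "\<And>z. z \<in> cball 0 R' \<Longrightarrow> W z \<le> W m"
    using continuous_attains_sup[OF compact_cball, of 0 R' W] by metis
  have "W z0 \<ge> 4 * e" using e by (simp add: W_def e_def)
  then have Wm: "W m \<ge> 4 * e" using m(2)[of z0] R' by simp
  have mD: "m \<in> ?D" using m(1) sub by blast
  then have m2: "(cmod m)\<^sup>2 < 1" by (simp add: abs_square_less_1)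
  have mR: "cmod m < R"
  proof (rule ccontr)
    assume "\<not> cmod m < R"
    then have "?V m \<le> e" using R(2) mD by simp
    moreover have "e * (cmod m)\<^sup>2 \<le> e * 1" using m2 e by (intro mult_left_mono) auto
    ultimately show False using Wm e unfolding W_def by linarith
  qed
  define d where "d = R - cmod m"
  have d: "d > 0" using mR by (simp add: d_def)
  define \<phi>1 \<phi>2 where "\<phi>1 = deriv \<phi>" and "\<phi>2 = deriv \<phi>1"
  define \<psi>1 \<psi>2 where "\<psi>1 = deriv \<psi>" and "\<psi>2 = deriv \<psi>1"
  define \<phi>3 \<psi>3 where "\<phi>3 = deriv \<phi>2" and "\<psi>3 = deriv \<psi>2"
  have D: "(\<phi> has_field_derivative \<phi>1 z) (at z)" "(\<phi>1 has_field_derivative \<phi>2 z) (at z)"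
    "(\<phi>2 has_field_derivative \<phi>3 z) (at z)"
    "(\<psi> has_field_derivative \<psi>1 z) (at z)" "(\<psi>1 has_field_derivative \<psi>2 z) (at z)"
    "(\<psi>2 has_field_derivative \<psi>3 z) (at z)" if "z \<in> ?D" for z
    using that hol unfolding \<phi>1_def \<phi>2_def \<psi>1_def \<psi>2_def \<phi>3_def \<psi>3_def
    by (auto intro!: holomorphic_derivI[OF _ open_ball] holomorphic_deriv[OF _ open_ball])
  \<comment> \<open>the second derivative of \<open>W\<close> at its maximum \<open>m\<close> in the direction \<open>c\<close>\<close>
  have key: "2 * (\<phi>1 m \<bullet> (c * c * \<phi>3 m)) + 2 * (cmod (c * \<phi>2 m))\<^sup>2
      + (2 * (\<psi>1 m \<bullet> (c * c * \<psi>3 m)) + 2 * (cmod (c * \<psi>2 m))\<^sup>2)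
      - (2 * ((m * \<phi>1 m - \<phi> m) \<bullet> (c * c * (\<phi>2 m + m * \<phi>3 m))) + 2 * (cmod (c * (m * \<phi>2 m)))\<^sup>2)
      - (2 * ((m * \<psi>1 m - \<psi> m) \<bullet> (c * c * (\<psi>2 m + m * \<psi>3 m))) + 2 * (cmod (c * (m * \<psi>2 m)))\<^sup>2)
      + e * (2 * (m \<bullet> (c * c * 0)) + 2 * (cmod (c * 1))\<^sup>2) \<le> 0"
    (is "?second \<le> 0") if c: "cmod c = 1" for c
  proof -
    let ?l = "\<lambda>t. m + of_real t * c"
    have l: "cmod (?l t) < R" if "\<bar>t\<bar> < d" for t
    proof -
      have "cmod (?l t) \<le> cmod m + cmod (of_real t * c)" by (rule norm_triangle_ineq)
      then show ?thesis using that c by (simp add: norm_mult d_def)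
    qed
    have lD: "?l t \<in> ?D" if "\<bar>t\<bar> < d" for t using l[OF that] R by simp
    have Dm: "((\<lambda>z. z * \<phi>1 z - \<phi> z) has_field_derivative z * \<phi>2 z) (at z)"
      "((\<lambda>z. z * \<psi>1 z - \<psi> z) has_field_derivative z * \<psi>2 z) (at z)"
      "((\<lambda>z. z * \<phi>2 z) has_field_derivative \<phi>2 z + z * \<phi>3 z) (at z)"
      "((\<lambda>z. z * \<psi>2 z) has_field_derivative \<psi>2 z + z * \<psi>3 z) (at z)" if "z \<in> ?D" for z
      by (rule derivative_eq_intros D that refl | simp)+
    note L = square_norm_along_line[where e = c and z = m, OF refl]
    note M = square_norm_along_line2[where e = c and z = m and t = 0 and w = m]
    have We: "W = (\<lambda>z. (cmod (\<phi>1 z))\<^sup>2 + (cmod (\<psi>1 z))\<^sup>2 - (cmod (z * \<phi>1 z - \<phi> z))\<^sup>2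
        - (cmod (z * \<psi>1 z - \<psi> z))\<^sup>2 + e * (cmod z)\<^sup>2)"
      by (simp add: W_def defect_fun_def \<phi>1_def \<psi>1_def fun_eq_iff)
    show ?thesis
    proof (rule second_deriv_nonpos_at_local_max[OF d, where u = "\<lambda>t. W (?l t)"])
      show "((\<lambda>t. W (?l t)) has_real_derivative
          2 * (\<phi>1 (?l t) \<bullet> (c * \<phi>2 (?l t))) + 2 * (\<psi>1 (?l t) \<bullet> (c * \<psi>2 (?l t)))
          - 2 * ((?l t * \<phi>1 (?l t) - \<phi> (?l t)) \<bullet> (c * (?l t * \<phi>2 (?l t))))
          - 2 * ((?l t * \<psi>1 (?l t) - \<psi> (?l t)) \<bullet> (c * (?l t * \<psi>2 (?l t))))
          + e * (2 * (?l t \<bullet> (c * 1)))) (at t)" if t: "\<bar>t\<bar> < d" for t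
        unfolding We
        by (intro DERIV_add DERIV_diff DERIV_cmult L D Dm lD DERIV_ident t)
      show "((\<lambda>t. 2 * (\<phi>1 (?l t) \<bullet> (c * \<phi>2 (?l t))) + 2 * (\<psi>1 (?l t) \<bullet> (c * \<psi>2 (?l t)))
          - 2 * ((?l t * \<phi>1 (?l t) - \<phi> (?l t)) \<bullet> (c * (?l t * \<phi>2 (?l t))))
          - 2 * ((?l t * \<psi>1 (?l t) - \<psi> (?l t)) \<bullet> (c * (?l t * \<psi>2 (?l t))))
          + e * (2 * (?l t \<bullet> (c * 1)))) has_real_derivative ?second) (at 0)"
        by (intro DERIV_add DERIV_diff DERIV_cmult M D Dm mD DERIV_ident DERIV_const) simp_all
      show "W (?l t) \<le> W (?l 0)" if "\<bar>t\<bar> < d" for t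
        using m(2)[of "?l t"] l[OF that] R'(3) by simp
    qed
  qed
  \<comment> \<open>in the sum over the directions 1 and \<open>\<i>\<close> the terms with \<open>c * c\<close> cancel, which leaves the Laplacian\<close>
  define q where "q = (cmod (\<phi>2 m))\<^sup>2 + (cmod (\<psi>2 m))\<^sup>2"
  have "4 * ((1 - (cmod m)\<^sup>2) * q) + 4 * e \<le> 0"
    using key[of 1] key[of \<i>] by (simp add: norm_mult power_mult_distrib q_def algebra_simps)
  moreover have "(1 - (cmod m)\<^sup>2) * q \<ge> 0" using m2 by (simp add: q_def)
  ultimately show False using e by linarith
qed

section \<open>The sharp second-coefficient inequality\<close>

text \<open>
  The functions \<open>\<phi> = (g')\<^bsup>-1/2\<^esup>\<close> and \<open>\<psi> = g \<phi>\<close> solve the linear equation \<open>2 y'' + S y = 0\<close>, with \<open>S\<close>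
  the Schwarzian derivative of \<open>g\<close>, and have Wronskian 1. The spherical derivative of \<open>g\<close> is
  \<open>1 / (|\<phi>|\<^sup>2 + |\<psi>|\<^sup>2)\<close>.
\<close>

lemma univalent_liouville_pair:
  assumes hol: "g holomorphic_on ball 0 1" and inj: "inj_on g (ball 0 1)"
  obtains \<phi> \<psi> where "\<phi> holomorphic_on ball 0 1" "\<psi> holomorphic_on ball 0 1"
    "\<And>z. z \<in> ball 0 1 \<Longrightarrow> (\<phi> z)\<^sup>2 * deriv g z = 1"
    "\<And>z. z \<in> ball 0 1 \<Longrightarrow> 2 * deriv \<phi> z * deriv g z = - \<phi> z * deriv (deriv g) z"
    "\<And>z. z \<in> ball 0 1 \<Longrightarrow> \<psi> z = g z * \<phi> z"
    "\<And>z. z \<in> ball 0 1 \<Longrightarrow> deriv \<psi> z = deriv g z * \<phi> z + g z * deriv \<phi> z"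
proof -
  let ?D = "ball (0::complex) 1"
  have g0: "deriv g z \<noteq> 0" if "z \<in> ?D" for z
    using holomorphic_injective_imp_regular[OF hol _ inj that] by simp
  have "(\<lambda>z. 1 / deriv g z) holomorphic_on ?D"
    using g0 holomorphic_deriv[OF hol open_ball] by (intro holomorphic_on_divide holomorphic_on_const) auto
  moreover have "contractible ?D" by (simp add: convex_imp_contractible)
  ultimately obtain \<phi> where \<phi>: "\<phi> holomorphic_on ?D" "\<And>z. z \<in> ?D \<Longrightarrow> 1 / deriv g z = (\<phi> z)\<^sup>2"
    using contractible_imp_holomorphic_sqrt[of "\<lambda>z. 1 / deriv g z" ?D] g0
    by (metis divide_eq_0_iff zero_neq_one)
  have sq: "(\<phi> z)\<^sup>2 * deriv g z = 1" if "z \<in> ?D" for z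
    using \<phi>(2)[OF that] g0[OF that] by (simp add: field_simps)
  have D: "(\<phi> has_field_derivative deriv \<phi> z) (at z)" "(g has_field_derivative deriv g z) (at z)"
    "(deriv g has_field_derivative deriv (deriv g) z) (at z)" if "z \<in> ?D" for z
    using that hol \<phi>(1) by (auto intro!: holomorphic_derivI[OF _ open_ball] holomorphic_deriv[OF _ open_ball])
  show ?thesis
  proof (rule that[of \<phi> "\<lambda>z. g z * \<phi> z"])
    show "(\<lambda>z. g z * \<phi> z) holomorphic_on ?D" using hol \<phi>(1) by (intro holomorphic_intros)
    fix z assume z: "z \<in> ?D"
    show "(\<phi> z)\<^sup>2 * deriv g z = 1" using sq z .
    show "deriv (\<lambda>z. g z * \<phi> z) z = deriv g z * \<phi> z + g z * deriv \<phi> z"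
      using DERIV_imp_deriv[OF DERIV_mult[OF D(2,1)]] z by (simp add: algebra_simps)
    have "((\<lambda>z. (\<phi> z)\<^sup>2 * deriv g z) has_field_derivative
        2 * \<phi> z * deriv \<phi> z * deriv g z + (\<phi> z)\<^sup>2 * deriv (deriv g) z) (at z)"
      by (rule derivative_eq_intros D z refl)+ (simp add: algebra_simps)
    moreover have "((\<lambda>z. (\<phi> z)\<^sup>2 * deriv g z) has_field_derivative 0) (at z)"
      by (rule has_field_derivative_transform_within_open[OF DERIV_const, of ?D]) (use z sq in auto)
    ultimately have "2 * \<phi> z * deriv \<phi> z * deriv g z + (\<phi> z)\<^sup>2 * deriv (deriv g) z = 0"
      by (rule DERIV_unique)
    then have "\<phi> z * (2 * deriv \<phi> z * deriv g z + \<phi> z * deriv (deriv g) z) = 0"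
      by (simp add: algebra_simps power2_eq_square)
    moreover have "\<phi> z \<noteq> 0" using sq[OF z] by auto
    ultimately show "2 * deriv \<phi> z * deriv g z = - \<phi> z * deriv (deriv g) z"
      by (simp add: add_eq_0_iff2)
  qed (use \<phi>(1) in auto)
qed

lemma lagrange_identity_complex:
  "((cmod a1)\<^sup>2 + (cmod p1)\<^sup>2) * ((cmod a)\<^sup>2 + (cmod p)\<^sup>2)
     = (cmod (a1 * cnj a + p1 * cnj p))\<^sup>2 + (cmod (a * p1 - a1 * p))\<^sup>2"
  unfolding cmod_power2 by (simp add: power2_eq_square algebra_simps)

lemma defect_expand:
  "(cmod a1)\<^sup>2 + (cmod p1)\<^sup>2 - (cmod (z * a1 - a))\<^sup>2 - (cmod (z * p1 - p))\<^sup>2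
     = (1 - (cmod z)\<^sup>2) * ((cmod a1)\<^sup>2 + (cmod p1)\<^sup>2) + 2 * Re (z * (a1 * cnj a + p1 * cnj p))
       - ((cmod a)\<^sup>2 + (cmod p)\<^sup>2)"
  unfolding cmod_power2 by (simp add: power2_eq_square algebra_simps)

text \<open>
  By Lagrange's identity and the Wronskian, \<open>(|a1|\<^sup>2 + |p1|\<^sup>2) E = |K|\<^sup>2 + 1\<close>; completing the square
  then expresses the defect by \<open>d K + cnj z E = - A E\<close>.
\<close>

lemma defect_completed_square:
  fixes a a1 p p1 z K :: complex and d E :: real
  assumes wr: "a * p1 - a1 * p = 1"
  defines "d \<equiv> 1 - (cmod z)\<^sup>2" and "E \<equiv> (cmod a)\<^sup>2 + (cmod p)\<^sup>2" and "K \<equiv> a1 * cnj a + p1 * cnj p"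
  shows "d * E * ((cmod a1)\<^sup>2 + (cmod p1)\<^sup>2 - (cmod (z * a1 - a))\<^sup>2 - (cmod (z * p1 - p))\<^sup>2)
           = (cmod (d * K + cnj z * E))\<^sup>2 - E\<^sup>2 + d\<^sup>2"
proof -
  define T where "T = (cmod a1)\<^sup>2 + (cmod p1)\<^sup>2"
  have TE: "T * E = (cmod K)\<^sup>2 + 1"
    using lagrange_identity_complex[of a1 p1 a p] wr by (simp add: T_def E_def K_def)
  have "(cmod (d * K + cnj z * E))\<^sup>2 = d\<^sup>2 * (cmod K)\<^sup>2 + 2 * d * E * Re (z * K) + (cmod z)\<^sup>2 * E\<^sup>2"
    unfolding cmod_power2 by (simp add: power2_eq_square algebra_simps)
  also have "\<dots> - E\<^sup>2 + d\<^sup>2 = d\<^sup>2 * (T * E) + 2 * d * E * Re (z * K) - d * E\<^sup>2"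
    unfolding TE by (simp add: d_def algebra_simps)
  also have "\<dots> = d * E * (d * T + 2 * Re (z * K) - E)"
    by (simp add: algebra_simps power2_eq_square)
  also have "d * T + 2 * Re (z * K) - E
      = (cmod a1)\<^sup>2 + (cmod p1)\<^sup>2 - (cmod (z * a1 - a))\<^sup>2 - (cmod (z * p1 - p))\<^sup>2"
    by (simp only: defect_expand T_def E_def K_def d_def)
  finally show ?thesis ..
qed

text \<open>
  The bound \<open>|A| \<le> 1\<close> is too weak by the term \<open>\<rho>\<^sup>2\<close>, but it gives \<open>V \<le> \<rho>\<close> for the defect
  \<open>V = (|A|\<^sup>2 - 1) / \<rho> + \<rho>\<close>. Since \<open>\<rho> \<le> (1 - |z|\<^sup>2) |g'|\<close> tends to 0 at the boundary, the maximum
  principle improves this to \<open>V \<le> 0\<close>.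
\<close>

lemma spherically_convex_defect_nonpos:
  assumes hol: "g holomorphic_on ball 0 1" and inj: "inj_on g (ball 0 1)"
    and conv: "spherically_convex_domain (Some ` g ` ball 0 1)" and g0: "g 0 = 0"
    and hol2: "\<phi> holomorphic_on ball 0 1" "\<psi> holomorphic_on ball 0 1"
    and sq: "\<And>z. z \<in> ball 0 1 \<Longrightarrow> (\<phi> z)\<^sup>2 * deriv g z = 1"
    and d\<phi>: "\<And>z. z \<in> ball 0 1 \<Longrightarrow> 2 * deriv \<phi> z * deriv g z = - \<phi> z * deriv (deriv g) z"
    and \<psi>: "\<And>z. z \<in> ball 0 1 \<Longrightarrow> \<psi> z = g z * \<phi> z"
    and d\<psi>: "\<And>z. z \<in> ball 0 1 \<Longrightarrow> deriv \<psi> z = deriv g z * \<phi> z + g z * deriv \<phi> z"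
    and z0: "z0 \<in> ball 0 1"
  shows "defect_fun \<phi> \<psi> z0 \<le> 0"
proof (rule defect_fun_max_principle[OF hol2 _ z0])
  let ?D = "ball (0::complex) 1"
  have le: "defect_fun \<phi> \<psi> z \<le> (1 - (cmod z)\<^sup>2) * cmod (deriv g z)" if z: "z \<in> ?D" for z
  proof -
    define a a1 b b1 b2 where "a = \<phi> z" and "a1 = deriv \<phi> z" and "b = g z"
      and "b1 = deriv g z" and "b2 = deriv (deriv g) z"
    have ab: "a * a * b1 = 1" and a1: "2 * a1 * b1 = - a * b2"
      using sq[OF z] d\<phi>[OF z] by (simp_all add: a_def a1_def b1_def b2_def power2_eq_square)
    have nz: "a \<noteq> 0" "b1 \<noteq> 0" using ab by auto
    define p p1 where "p = \<psi> z" and "p1 = deriv \<psi> z"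
    have p: "p = b * a" "p1 = b1 * a + b * a1"
      using \<psi>[OF z] d\<psi>[OF z] by (simp_all add: p_def p1_def a_def a1_def b_def b1_def)
    define d where "d = 1 - (cmod z)\<^sup>2"
    have d: "d > 0" using z by (simp add: d_def abs_square_less_1)
    define E where "E = (cmod a)\<^sup>2 + (cmod p)\<^sup>2"
    have Ec: "E = (cmod a)\<^sup>2 * (1 + (cmod b)\<^sup>2)"
      by (simp add: E_def p norm_mult power_mult_distrib algebra_simps)
    have E: "E > 0" using nz one_plus_cmod_sq_pos[of b] by (simp add: Ec)
    define K where "K = a1 * cnj a + p1 * cnj p"
    have wr: "a * p1 - a1 * p = 1" using ab by (simp add: p algebra_simps)
    define C where "C = 1 + b * cnj b"
    have Cr: "C = of_real (1 + (cmod b)\<^sup>2)" by (simp add: C_def complex_norm_square del: of_real_power)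
    have C0: "C \<noteq> 0" unfolding Cr using one_plus_cmod_sq_pos[of b] by (metis of_real_eq_0_iff less_irrefl)
    have EC: "of_real E = a * cnj a * C"
      unfolding Ec Cr of_real_mult by (simp only: complex_norm_square)
    have a1': "a1 = - a * b2 / (2 * b1)" using a1 nz by (simp add: field_simps)
    define Y where "Y = b2 / (2 * b1) - cnj b * b1 / C"
    have "K = - (a * cnj a * C * Y)"
      using nz C0 unfolding K_def p a1' Y_def by (simp add: field_simps) (simp add: C_def algebra_simps)
    then have "d * K + cnj z * E = - (of_real E * (d * Y - cnj z))"
      unfolding EC by (simp add: algebra_simps)
    then have "cmod (d * K + cnj z * E)
        = E * cmod (d * (b2 / (2 * b1) - cnj b * b1 / C) - cnj z)"
      using E by (simp only: norm_minus_cancel norm_mult norm_of_real Y_def abs_of_pos)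
    also have "\<dots> \<le> E * 1"
      using spherically_convex_second_coefficient[OF hol inj conv z] E
      unfolding a_def[symmetric] b_def[symmetric] b1_def[symmetric] b2_def[symmetric] Cr d_def
      by (intro mult_left_mono) auto
    finally have "cmod (d * K + cnj z * E) \<le> E" by simp
    then have sqle: "(cmod (d * K + cnj z * E))\<^sup>2 \<le> E\<^sup>2" by (intro power_mono) auto
    have V: "defect_fun \<phi> \<psi> z = (cmod a1)\<^sup>2 + (cmod p1)\<^sup>2 - (cmod (z * a1 - a))\<^sup>2 - (cmod (z * p1 - p))\<^sup>2"
      by (simp add: defect_fun_def a_def a1_def p_def p1_def)
    have "d * E * defect_fun \<phi> \<psi> z = (cmod (d * K + cnj z * E))\<^sup>2 - E\<^sup>2 + d\<^sup>2"
      unfolding V d_def E_def K_def by (rule defect_completed_square[OF wr])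
    then have "d * (E * defect_fun \<phi> \<psi> z) \<le> d * d"
      using sqle by (simp add: power2_eq_square mult.assoc)
    then have "E * defect_fun \<phi> \<psi> z \<le> d" using d by (simp only: mult_le_cancel_left_pos)
    also have "d \<le> E * (d * cmod b1)"
    proof -
      have "(cmod a)\<^sup>2 * cmod b1 = 1"
        using arg_cong[OF ab, of cmod] by (simp add: norm_mult power2_eq_square)
      then have "E * (d * cmod b1) = d * (1 + (cmod b)\<^sup>2)"
        by (simp add: Ec)
      then show ?thesis using d by simp
    qed
    finally have "E * defect_fun \<phi> \<psi> z \<le> E * (d * cmod b1)" .
    then show ?thesis using E by (simp add: d_def b1_def)
  qed
  fix e :: real assume "e > 0"
  have zero: "0 \<in> g ` ?D" using g0 by (metis centre_in_ball image_eqI zero_less_one)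
  obtain R where R: "R < 1" "\<forall>z. R \<le> cmod z \<longrightarrow> cmod z < 1 \<longrightarrow> (1 - (cmod z)\<^sup>2) * cmod (deriv g z) < e"
    using univalent_convex_bounded_decay[OF hol inj convex_spherically_convex_0[OF conv zero]
        bounded_spherically_convex_0[OF conv zero] \<open>e > 0\<close>] by blast
  have "defect_fun \<phi> \<psi> z \<le> e" if "R \<le> cmod z" "cmod z < 1" for z
    using R(2) le[of z] that by fastforce
  then show "\<exists>R<1. \<forall>z. R \<le> cmod z \<longrightarrow> cmod z < 1 \<longrightarrow> defect_fun \<phi> \<psi> z \<le> e"
    using R(1) by (intro exI[of _ R]) simp
qed

section \<open>Means over circles\<close>

text \<open>
  Integrating \<open>F_xx + F_tt + c F_x \<ge> 0\<close> over a period in \<open>t\<close> removes \<open>F_tt\<close> and leaves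
  \<open>M'' + c M' \<ge> 0\<close> for the mean \<open>M\<close>. With the integrating factor \<open>\<mu>\<close> this says that \<open>\<mu> M'\<close> is
  nondecreasing. A negative value of \<open>M'\<close> would keep \<open>M'\<close> below a negative constant further to the
  left, and \<open>M\<close> would be unbounded above near \<open>-\<infinity>\<close>; hence \<open>M' \<ge> 0\<close>. A zero of \<open>M'\<close> forces
  \<open>M' = 0\<close> to its left, so that the nonnegative integrand vanishes there.
\<close>

lemma mean_monotone_of_subsolution:
  fixes F Fx Fxx Ft Ftt :: "real \<Rightarrow> real \<Rightarrow> real" and c \<mu> :: "real \<Rightarrow> real"
  assumes l: "l > 0"
    and F1: "\<And>x t. x < 0 \<Longrightarrow> ((\<lambda>x. F x t) has_real_derivative Fx x t) (at x)"
    and F2: "\<And>x t. x < 0 \<Longrightarrow> ((\<lambda>x. Fx x t) has_real_derivative Fxx x t) (at x)"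
    and cF: "continuous_on ({..<0} \<times> UNIV) (\<lambda>(x, t). F x t)"
    and cFx: "continuous_on ({..<0} \<times> UNIV) (\<lambda>(x, t). Fx x t)"
    and cFxx: "continuous_on ({..<0} \<times> UNIV) (\<lambda>(x, t). Fxx x t)"
    and Ft: "\<And>x t. x < 0 \<Longrightarrow> ((\<lambda>t. Ft x t) has_real_derivative Ftt x t) (at t)"
    and cFtt: "continuous_on ({..<0} \<times> UNIV) (\<lambda>(x, t). Ftt x t)"
    and per: "\<And>x. x < 0 \<Longrightarrow> Ft x l = Ft x 0"
    and bd: "\<And>x t. x \<le> x1 \<Longrightarrow> F x t \<le> B"
    and \<mu>: "\<And>x. x < 0 \<Longrightarrow> (\<mu> has_real_derivative c x * \<mu> x) (at x)" "\<And>x. x < 0 \<Longrightarrow> \<mu> x > 0"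
    and c: "\<And>x. x < 0 \<Longrightarrow> c x \<ge> 0"
    and Q: "\<And>x t. x < 0 \<Longrightarrow> Fxx x t + Ftt x t + c x * Fx x t \<ge> 0"
  defines "M \<equiv> \<lambda>x. integral {0..l} (F x)" and "M' \<equiv> \<lambda>x. integral {0..l} (Fx x)"
  shows "x < 0 \<Longrightarrow> (M has_real_derivative M' x) (at x)"
    and "x < 0 \<Longrightarrow> M' x \<ge> 0"
    and "M' x0 = 0 \<Longrightarrow> x < x0 \<Longrightarrow> x0 < 0 \<Longrightarrow> t \<in> {0..l} \<Longrightarrow> Fxx x t + Ftt x t + c x * Fx x t = 0"
proof -
  define M'' where "M'' x = integral {0..l} (Fxx x)" for x
  have cont: "continuous_on {0..l} (G x)"
    if "continuous_on ({..<0} \<times> UNIV) (\<lambda>(x, t). G x t)" "x < 0" for G :: "real \<Rightarrow> real \<Rightarrow> real" and x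
  proof -
    have "continuous_on {0..l} (\<lambda>t. (x, t))" by (intro continuous_intros)
    from continuous_on_compose2[OF that(1) this] that(2) show ?thesis by auto
  qed
  have leib: "((\<lambda>x. integral {0..l} (G x)) has_real_derivative integral {0..l} (G' x)) (at x)"
    if "\<And>x t. x < 0 \<Longrightarrow> ((\<lambda>x. G x t) has_real_derivative G' x t) (at x)"
      "continuous_on ({..<0} \<times> UNIV) (\<lambda>(x, t). G x t)"
      "continuous_on ({..<0} \<times> UNIV) (\<lambda>(x, t). G' x t)" "x < 0"
    for G G' :: "real \<Rightarrow> real \<Rightarrow> real" and x
  proof -
    have "((\<lambda>x. integral (cbox 0 l) (G x)) has_real_derivative integral (cbox 0 l) (G' x)) (at x within {..<0})"
    proof (rule leibniz_rule_field_derivative)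
      show "((\<lambda>x. G x t) has_real_derivative G' x t) (at x within {..<0})" if "x \<in> {..<0}" for x t
        using \<open>\<And>x t. x < 0 \<Longrightarrow> ((\<lambda>x. G x t) has_real_derivative G' x t) (at x)\<close>[of x t] that
        by (simp add: has_field_derivative_at_within)
      show "G x integrable_on cbox 0 l" if "x \<in> {..<0}" for x
        using cont[OF \<open>continuous_on ({..<0} \<times> UNIV) (\<lambda>(x, t). G x t)\<close>] that
        by (auto intro!: integrable_continuous_interval)
      show "continuous_on ({..<0} \<times> cbox 0 l) (\<lambda>(x, t). G' x t)"
        using that(3) by (rule continuous_on_subset) auto
    qed (use that in auto)
    then show ?thesis using that(4) by (simp add: at_within_open[of x "{..<0}"])
  qed
  have M1: "(M has_real_derivative M' x) (at x)" if "x < 0" for x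
    unfolding M_def M'_def by (rule leib[OF F1 cF cFx that])
  have M2: "(M' has_real_derivative M'' x) (at x)" if "x < 0" for x
    unfolding M''_def M'_def by (rule leib[OF F2 cFx cFxx that])
  have intQ: "integral {0..l} (\<lambda>t. Fxx x t + Ftt x t + c x * Fx x t) = M'' x + c x * M' x" if x: "x < 0" for x
  proof -
    have "(Ftt x has_integral (Ft x l - Ft x 0)) {0..l}"
      by (rule fundamental_theorem_of_calculus)
         (use l Ft[OF x] in \<open>auto simp: has_real_derivative_iff_has_vector_derivative[symmetric]
            intro: has_field_derivative_at_within\<close>)
    then have "(Ftt x has_integral 0) {0..l}" using per[OF x] by simp
    moreover have "(Fxx x has_integral M'' x) {0..l}" "(Fx x has_integral M' x) {0..l}"
      unfolding M''_def M'_def using cont[OF cFxx x] cont[OF cFx x]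
      by (auto intro!: integrable_integral integrable_continuous_interval)
    ultimately have "((\<lambda>t. Fxx x t + Ftt x t + c x * Fx x t) has_integral (M'' x + 0 + c x * M' x)) {0..l}"
      by (intro has_integral_add has_integral_mult_right)
    then show ?thesis by (simp add: integral_unique)
  qed
  have slack: "M'' x + c x * M' x \<ge> 0" if "x < 0" for x
    unfolding intQ[OF that, symmetric] by (rule integral_nonneg)
      (use that Q cont[OF cFxx that] cont[OF cFtt that] cont[OF cFx that] in
        \<open>auto intro!: integrable_continuous_interval continuous_intros\<close>)
  have mono: "\<mu> x * M' x \<le> \<mu> y * M' y" if "x \<le> y" "y < 0" for x y
  proof (rule DERIV_nonneg_imp_nondecreasing[OF that(1)])
    fix s assume "x \<le> s" "s \<le> y"
    then have s: "s < 0" using that by simp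
    have "((\<lambda>x. \<mu> x * M' x) has_real_derivative \<mu> s * (M'' s + c s * M' s)) (at s)"
      by (rule derivative_eq_intros \<mu>(1) M2 s refl)+ (simp add: algebra_simps)
    moreover have "\<mu> s * (M'' s + c s * M' s) \<ge> 0" using slack[OF s] \<mu>(2)[OF s] by simp
    ultimately show "\<exists>y. ((\<lambda>x. \<mu> x * M' x) has_real_derivative y) (at s) \<and> 0 \<le> y" by blast
  qed
  have mono\<mu>: "\<mu> x \<le> \<mu> y" if "x \<le> y" "y < 0" for x y
  proof (rule DERIV_nonneg_imp_nondecreasing[OF that(1)])
    fix s assume "x \<le> s" "s \<le> y"
    then have s: "s < 0" using that by simp
    have "c s * \<mu> s \<ge> 0" using c[OF s] \<mu>(2)[OF s] by simp
    then show "\<exists>y. (\<mu> has_real_derivative y) (at s) \<and> 0 \<le> y" using \<mu>(1)[OF s] by blast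
  qed
  have Mbd: "M x \<le> l * B" if "x \<le> x1" "x < 0" for x
  proof -
    have "integral {0..l} (F x) \<le> integral {0..l} (\<lambda>_. B)"
      using cont[OF cF that(2)] bd[OF that(1)]
      by (intro integral_le integrable_continuous_interval) auto
    then show ?thesis using l by (simp add: M_def)
  qed
  have nonneg: "M' x \<ge> 0" if x: "x < 0" for x
  proof (rule ccontr)
    assume "\<not> M' x \<ge> 0"
    then have neg: "M' x < 0" by simp
    have slope: "M' s \<le> M' x" if "s \<le> x" for s
    proof -
      have s: "s < 0" using that x by simp
      have "\<mu> s * M' s \<le> \<mu> x * M' x" by (rule mono[OF that x])
      also have "\<dots> \<le> \<mu> s * M' x" using mono\<mu>[OF that x] neg by (intro mult_right_mono_neg) auto
      finally show ?thesis using \<mu>(2)[OF s] by simp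
    qed
    \<comment> \<open>so far to the left of \<open>x\<close> that the slope \<open>M' x < 0\<close> lifts \<open>M\<close> above its bound\<close>
    define y where "y = min x x1 - (\<bar>l * B\<bar> + \<bar>M x\<bar> + 1) / (- M' x)"
    have pos: "(\<bar>l * B\<bar> + \<bar>M x\<bar> + 1) / (- M' x) > 0"
      using neg by (intro divide_pos_pos) auto
    have y: "y < x" "y \<le> x1" using pos by (auto simp: y_def)
    obtain \<xi> where xi: "y < \<xi>" "\<xi> < x" "M x - M y = (x - y) * M' \<xi>"
      using MVT2[OF y(1), of M M'] M1 x by force
    have "(x - y) * M' \<xi> \<le> (x - y) * M' x" using slope[of \<xi>] xi y by (intro mult_left_mono) auto
    moreover have "(x - y) * (- M' x) \<ge> ((\<bar>l * B\<bar> + \<bar>M x\<bar> + 1) / (- M' x)) * (- M' x)"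
      using neg by (intro mult_right_mono) (auto simp: y_def)
    then have "(x - y) * (- M' x) \<ge> \<bar>l * B\<bar> + \<bar>M x\<bar> + 1" using neg by simp
    ultimately have "M y \<ge> M x + \<bar>l * B\<bar> + \<bar>M x\<bar> + 1" using xi(3) by simp
    then have "M y > l * B" by linarith
    then show False using Mbd[of y] y x by simp
  qed
  show "x < 0 \<Longrightarrow> (M has_real_derivative M' x) (at x)" by (rule M1)
  show "x < 0 \<Longrightarrow> M' x \<ge> 0" by (rule nonneg)
  show "Fxx x t + Ftt x t + c x * Fx x t = 0"
    if x0: "M' x0 = 0" and x: "x < x0" "x0 < 0" and t: "t \<in> {0..l}"
  proof -
    have zero: "M' s = 0" if "s < x0" for s
    proof -
      have "\<mu> s * M' s \<le> 0" using mono[of s x0] that x x0 by simp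
      then have "M' s \<le> 0" using \<mu>(2)[of s] that x by (simp add: mult_le_0_iff)
      then show ?thesis using nonneg[of s] that x by simp
    qed
    have xn: "x < 0" using x by simp
    have "(M' has_real_derivative 0) (at x)"
      by (rule has_field_derivative_transform_within_open[OF DERIV_const, of "{..<x0}"])
         (use x zero in auto)
    then have "M'' x = 0" using M2[OF xn] DERIV_unique by blast
    then have "integral {0..l} (\<lambda>t. Fxx x t + Ftt x t + c x * Fx x t) = 0"
      using intQ[OF xn] zero[OF x(1)] by simp
    moreover have "continuous_on {0..l} (\<lambda>t. Fxx x t + Ftt x t + c x * Fx x t)"
      using cont[OF cFxx xn] cont[OF cFtt xn] cont[OF cFx xn] by (intro continuous_intros)
    ultimately show ?thesis using integral_eq_0_iff[of 0 l "\<lambda>t. Fxx x t + Ftt x t + c x * Fx x t"] l Q[OF xn] t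
      by auto
  qed
qed

text \<open>
  The identity behind the monotonicity. Here \<open>R = |z|\<^sup>2\<close>, \<open>E = |\<phi>|\<^sup>2 + |\<psi>|\<^sup>2\<close>, and \<open>2 k1\<close>, \<open>2 k2\<close>,
  \<open>4 T\<close> are the two first derivatives and the Laplacian of \<open>E\<close> in logarithmic polar coordinates.
  The left side is \<open>F_xx + F_tt + c F_x\<close> for \<open>F = (1 + R) / E\<close>; the last factor on the right is
  minus the defect. The choice \<open>c = 8 R / (1 - R\<^sup>2)\<close> is exactly what completes the square.
\<close>

lemma liouville_quotient_identity:
  fixes R E k1 k2 T :: real
  assumes R: "0 < R" "R < 1" and E: "E > 0" and T: "T * E = k1\<^sup>2 + k2\<^sup>2 + R"
  shows "4 * R / E - 4 * R * (2 * k1) / E\<^sup>2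
      - (1 + R) * (4 * T / E\<^sup>2 - 8 * (k1\<^sup>2 + k2\<^sup>2) / E ^ 3)
      + 8 * R / (1 - R\<^sup>2) * (2 * R / E - (1 + R) * (2 * k1) / E\<^sup>2)
    = (1 + R) / E * (8 * ((k1 / E - R / (1 + R))\<^sup>2 + (k2 / E)\<^sup>2)
        + 4 * R / ((1 - R) * E) * (E - (1 - R) * T / R - 2 * k1))"
proof -
  define p q e where "p = 1 / (1 + R)" and "q = 1 / (1 - R)" and "e = 1 / E"
  define j1 j2 where "j1 = k1 * e" and "j2 = k2 * e"
  have pq: "p * (1 + R) = 1" "q * (1 - R) = 1" and eE: "e * E = 1"
    using R E by (simp_all add: p_def q_def e_def)
  have T': "T * e = j1\<^sup>2 + j2\<^sup>2 + R * e\<^sup>2"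
  proof -
    have "T * e = (T * E) * e\<^sup>2" using eE by algebra
    then show ?thesis unfolding T j1_def j2_def by (simp add: algebra_simps power_mult_distrib)
  qed
  have R2: "1 / (1 - R\<^sup>2) = p * q"
    using R by (simp add: p_def q_def power2_eq_square algebra_simps)
  have "4 * R / E - 4 * R * (2 * k1) / E\<^sup>2
      - (1 + R) * (4 * T / E\<^sup>2 - 8 * (k1\<^sup>2 + k2\<^sup>2) / E ^ 3)
      + 8 * R / (1 - R\<^sup>2) * (2 * R / E - (1 + R) * (2 * k1) / E\<^sup>2)
    = 4 * R * e - 4 * R * (2 * k1) * e\<^sup>2
      - (1 + R) * (4 * T * e\<^sup>2 - 8 * (k1\<^sup>2 + k2\<^sup>2) * e ^ 3)
      + 8 * R * (1 / (1 - R\<^sup>2)) * (2 * R * e - (1 + R) * (2 * k1) * e\<^sup>2)"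
    by (simp add: e_def power_one_over divide_inverse power_inverse)
  also have "\<dots> = e * (4 * R - 8 * R * j1 - (1 + R) * (4 * (T * e) - 8 * (j1\<^sup>2 + j2\<^sup>2))
      + 8 * R * (p * q) * (2 * R - 2 * (1 + R) * j1))"
    unfolding R2 j1_def j2_def by algebra
  also have "\<dots> = e * ((1 + R) * (8 * ((j1 - R * p)\<^sup>2 + j2\<^sup>2)
      + 4 * R * q * (1 - 2 * j1) - 4 * (T * e)))"
    unfolding T' using pq by algebra
  also have "\<dots> = (1 + R) * e * (8 * ((k1 * e - R * p)\<^sup>2 + (k2 * e)\<^sup>2)
        + 4 * R * (q * e) * (E - (1 - R) * T * (1 / R) - 2 * k1))"
  proof -
    have "R * (1 / R) = 1" using R by simp
    then have "4 * R * (q * e) * (E - (1 - R) * T * (1 / R) - 2 * k1)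
        = 4 * R * q * (1 - 2 * j1) - 4 * (T * e)"
      using pq eE unfolding j1_def by algebra
    then show ?thesis by (simp add: j1_def j2_def)
  qed
  also have "\<dots> = (1 + R) / E * (8 * ((k1 / E - R / (1 + R))\<^sup>2 + (k2 / E)\<^sup>2)
        + 4 * R / ((1 - R) * E) * (E - (1 - R) * T / R - 2 * k1))"
    by (simp add: p_def q_def e_def)
  finally show ?thesis .
qed

text \<open>
  Logarithmic polar coordinates: \<open>exp (log_polar x t)\<close> has modulus \<open>exp x\<close> and argument \<open>t\<close>. The
  factor 1 and the order of the summands present it as a line in direction 1
  with parameter \<open>x\<close>, matching \<open>square_norm_along_line\<close>.
\<close>

definition log_polar :: "real \<Rightarrow> real \<Rightarrow> complex" where
  "log_polar x t = of_real t * \<i> + of_real x * 1"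

lemma log_polar_swap: "log_polar x t = of_real x + of_real t * \<i>"
  by (simp add: log_polar_def)

lemma continuous_on_log_polar [continuous_intros]: "continuous_on S (\<lambda>(x, t). log_polar x t)"
  unfolding log_polar_def case_prod_unfold by (intro continuous_intros)

lemma square_norm_log_polar:
  assumes F: "(F has_field_derivative F1 (log_polar x t)) (at (log_polar x t))"
    and F1: "(F1 has_field_derivative F2 (log_polar x t)) (at (log_polar x t))"
  shows "((\<lambda>x. (cmod (F (log_polar x t)))\<^sup>2) has_real_derivative
            2 * (F (log_polar x t) \<bullet> F1 (log_polar x t))) (at x)"
    and "((\<lambda>x. 2 * (F (log_polar x t) \<bullet> F1 (log_polar x t))) has_real_derivative
            2 * (F (log_polar x t) \<bullet> F2 (log_polar x t)) + 2 * (cmod (F1 (log_polar x t)))\<^sup>2) (at x)"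
    and "((\<lambda>t. (cmod (F (log_polar x t)))\<^sup>2) has_real_derivative
            2 * (F (log_polar x t) \<bullet> (\<i> * F1 (log_polar x t)))) (at t)"
    and "((\<lambda>t. 2 * (F (log_polar x t) \<bullet> (\<i> * F1 (log_polar x t)))) has_real_derivative
            2 * (cmod (F1 (log_polar x t)))\<^sup>2 - 2 * (F (log_polar x t) \<bullet> F2 (log_polar x t))) (at t)"
  using square_norm_along_line[OF log_polar_def[symmetric] F]
    square_norm_along_line2[OF log_polar_def[symmetric] F F1]
    square_norm_along_line[OF log_polar_swap[symmetric] F]
    square_norm_along_line2[OF log_polar_swap[symmetric] F F1]
  by (simp_all only: log_polar_def[symmetric] log_polar_swap[symmetric])
     (simp_all add: norm_mult algebra_simps)

lemma DERIV_over:
  fixes g e :: "real \<Rightarrow> real"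
  assumes "(g has_real_derivative g') (at x)" "(e has_real_derivative e') (at x)" "e x \<noteq> 0"
  shows "((\<lambda>x. g x / e x) has_real_derivative g' / e x - g x * e' / (e x)\<^sup>2) (at x)"
  by (rule DERIV_cong[OF DERIV_divide[OF assms]])
     (use assms(3) in \<open>simp add: field_simps power2_eq_square\<close>)

lemma DERIV_over_square:
  fixes g e :: "real \<Rightarrow> real"
  assumes "(g has_real_derivative g') (at x)" "(e has_real_derivative e') (at x)" "e x \<noteq> 0"
  shows "((\<lambda>x. g x / (e x)\<^sup>2) has_real_derivative g' / (e x)\<^sup>2 - 2 * g x * e' / (e x) ^ 3) (at x)"
proof -
  have "((\<lambda>x. (e x)\<^sup>2) has_real_derivative 2 * e x * e') (at x)"
    using assms(2) by (auto intro!: derivative_eq_intros)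
  from DERIV_cong[OF DERIV_over[OF assms(1) this]] show ?thesis
    using assms(3) by (simp add: power2_eq_square power3_eq_cube mult.assoc mult.left_commute)
qed

text \<open>
  \<open>M x\<close> is \<open>2 \<pi>\<close> times the mean of \<open>F = (1 + |z|\<^sup>2) / N\<close> over the circle of radius \<open>exp x\<close>. By
  \<open>liouville_quotient_identity\<close>, a nonpositive defect makes \<open>F\<close> satisfy the hypothesis of \<open>mean_monotone_of_subsolution\<close>, with integrating factor
  \<open>\<mu> = ((1 + R) / (1 - R))\<^sup>2\<close>. In the equality case both the square and the defect vanish on a disc,
  and with \<open>T N = k1\<^sup>2 + k2\<^sup>2 + R\<close> these equations determine \<open>N\<close> and \<open>T\<close>.
\<close>

lemma circular_mean_of_quotient:
  fixes \<phi> \<psi> :: "complex \<Rightarrow> complex"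
  assumes hol: "\<phi> holomorphic_on ball 0 1" "\<psi> holomorphic_on ball 0 1"
    and wr: "\<And>z. z \<in> ball 0 1 \<Longrightarrow> \<phi> z * deriv \<psi> z - deriv \<phi> z * \<psi> z = 1"
    and V: "\<And>z. z \<in> ball 0 1 \<Longrightarrow> defect_fun \<phi> \<psi> z \<le> 0"
  defines "N \<equiv> \<lambda>z. (cmod (\<phi> z))\<^sup>2 + (cmod (\<psi> z))\<^sup>2"
  defines "M \<equiv> \<lambda>x. integral {0..2 * pi} (\<lambda>t. (1 + exp (2 * x)) / N (exp (log_polar x t)))"
  assumes x0: "x0 < 0"
  shows "\<exists>D\<ge>0. (M has_real_derivative D) (at x0) \<and>
    (D = 0 \<longrightarrow> (\<forall>z. 0 < cmod z \<and> cmod z < exp x0 \<longrightarrow>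
        N z = 1 + (cmod z)\<^sup>2 \<and> (cmod (deriv \<phi> z))\<^sup>2 + (cmod (deriv \<psi> z))\<^sup>2 = 1))"
proof -
  let ?D = "ball (0::complex) 1"
  let ?s = log_polar
  define H where "H = {s::complex. Re s < 0}"
  have expH: "exp s \<in> ?D" if "s \<in> H" for s using that by (simp add: H_def)
  have sH: "?s x t \<in> H" if "x < 0" for x t using that by (simp add: H_def log_polar_def)
  define a a1 a2 where "a s = \<phi> (exp s)" and "a1 s = exp s * deriv \<phi> (exp s)"
    and "a2 s = exp s * deriv \<phi> (exp s) + exp s * (exp s * deriv (deriv \<phi>) (exp s))" for s
  define p p1 p2 where "p s = \<psi> (exp s)" and "p1 s = exp s * deriv \<psi> (exp s)"
    and "p2 s = exp s * deriv \<psi> (exp s) + exp s * (exp s * deriv (deriv \<psi>) (exp s))" for s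
  have chain: "((\<lambda>s. F (exp s)) has_field_derivative exp s * deriv F (exp s)) (at s)"
    if "F holomorphic_on ?D" "s \<in> H" for F s
    using DERIV_chain2[OF holomorphic_derivI[OF that(1) open_ball expH[OF that(2)]] DERIV_exp]
    by (simp add: mult.commute)
  have Da: "(a has_field_derivative a1 s) (at s)" "(a1 has_field_derivative a2 s) (at s)"
    "(p has_field_derivative p1 s) (at s)" "(p1 has_field_derivative p2 s) (at s)" if s: "s \<in> H" for s
  proof -
    show "(a has_field_derivative a1 s) (at s)" "(p has_field_derivative p1 s) (at s)"
      unfolding a_def a1_def p_def p1_def by (rule chain[OF hol(1) s] chain[OF hol(2) s])+
    show "(a1 has_field_derivative a2 s) (at s)" "(p1 has_field_derivative p2 s) (at s)"
      unfolding a1_def a2_def p1_def p2_def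
      using chain[OF holomorphic_deriv[OF hol(1) open_ball] s] chain[OF holomorphic_deriv[OF hol(2) open_ball] s]
      by (auto intro!: derivative_eq_intros)
  qed
  have cont: "continuous_on ({..<0} \<times> UNIV) (\<lambda>y. F (?s (fst y) (snd y)))"
    if "continuous_on H F" for F :: "complex \<Rightarrow> complex"
    using continuous_on_compose2[OF that continuous_on_log_polar, of "{..<0} \<times> UNIV"] sH
    by (simp add: case_prod_unfold image_subset_iff mem_Times_iff)
  have contH: "continuous_on H a" "continuous_on H a1" "continuous_on H p" "continuous_on H p1"
    by (intro continuous_at_imp_continuous_on ballI; rule DERIV_isCont, erule Da)+
  have ce: "continuous_on H (\<lambda>s. F (exp s))" if "F holomorphic_on ?D" for F
    by (intro continuous_at_imp_continuous_on ballI; rule DERIV_isCont, erule chain[OF that])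
  have contH2: "continuous_on H a2" "continuous_on H p2"
    unfolding a2_def p2_def
    by (intro continuous_on_add continuous_on_mult ce holomorphic_deriv hol open_ball
        continuous_on_exp continuous_on_id)+
  note ct = cont[OF contH(1)] cont[OF contH(2)] cont[OF contH(3)] cont[OF contH(4)]
    cont[OF contH2(1)] cont[OF contH2(2)]
  define E where "E x t = (cmod (a (?s x t)))\<^sup>2 + (cmod (p (?s x t)))\<^sup>2" for x t
  define Ex where "Ex x t = 2 * (a (?s x t) \<bullet> a1 (?s x t)) + 2 * (p (?s x t) \<bullet> p1 (?s x t))" for x t
  define Et where "Et x t = 2 * (a (?s x t) \<bullet> (\<i> * a1 (?s x t))) + 2 * (p (?s x t) \<bullet> (\<i> * p1 (?s x t)))" for x t
  define J where "J x t = 2 * (a (?s x t) \<bullet> a2 (?s x t)) + 2 * (p (?s x t) \<bullet> p2 (?s x t))" for x t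
  define T where "T x t = (cmod (a1 (?s x t)))\<^sup>2 + (cmod (p1 (?s x t)))\<^sup>2" for x t
  have DE: "((\<lambda>x. E x t) has_real_derivative Ex x t) (at x)"
    "((\<lambda>x. Ex x t) has_real_derivative J x t + 2 * T x t) (at x)"
    "((\<lambda>t. E x t) has_real_derivative Et x t) (at t)"
    "((\<lambda>t. Et x t) has_real_derivative 2 * T x t - J x t) (at t)" if x: "x < 0" for x t
  proof -
    note A = square_norm_log_polar[where F = a and ?F1.0 = a1 and ?F2.0 = a2 and x = x and t = t,
        OF Da(1,2)[OF sH[OF x]]]
    note P = square_norm_log_polar[where F = p and ?F1.0 = p1 and ?F2.0 = p2 and x = x and t = t,
        OF Da(3,4)[OF sH[OF x]]]
    show "((\<lambda>x. E x t) has_real_derivative Ex x t) (at x)"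
      "((\<lambda>x. Ex x t) has_real_derivative J x t + 2 * T x t) (at x)"
      "((\<lambda>t. E x t) has_real_derivative Et x t) (at t)"
      "((\<lambda>t. Et x t) has_real_derivative 2 * T x t - J x t) (at t)"
      using DERIV_add[OF A(1) P(1)] DERIV_add[OF A(2) P(2)] DERIV_add[OF A(3) P(3)] DERIV_add[OF A(4) P(4)]
      unfolding E_def Ex_def Et_def J_def T_def by (simp_all add: algebra_simps)
  qed
  have Epos: "E x t > 0" if "x < 0" for x t
  proof (rule ccontr)
    assume "\<not> E x t > 0"
    moreover have "(cmod (a (?s x t)))\<^sup>2 \<ge> 0" "(cmod (p (?s x t)))\<^sup>2 \<ge> 0" by simp_all
    ultimately have "(cmod (a (?s x t)))\<^sup>2 = 0" "(cmod (p (?s x t)))\<^sup>2 = 0" unfolding E_def by linarith+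
    then show False using wr[OF expH[OF sH[OF that, of t]]] by (simp add: a_def p_def)
  qed
  define R where "R x = exp (2 * x)" for x :: real
  have DR: "(R has_real_derivative 2 * R x) (at x)" for x
    unfolding R_def by (auto intro!: derivative_eq_intros)
  have R01: "0 < R x" "R x < 1" if "x < 0" for x using that by (auto simp: R_def)
  have cmodz: "(cmod (exp (?s x t)))\<^sup>2 = R x" for x t
    by (simp add: R_def log_polar_def exp_double)
  define F where "F x t = (1 + R x) / E x t" for x t
  define Fx where "Fx x t = 2 * R x / E x t - (1 + R x) * Ex x t / (E x t)\<^sup>2" for x t
  define Fxx where "Fxx x t = 4 * R x / E x t - 4 * R x * Ex x t / (E x t)\<^sup>2
      - (1 + R x) * ((J x t + 2 * T x t) / (E x t)\<^sup>2 - 2 * (Ex x t)\<^sup>2 / (E x t) ^ 3)" for x t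
  define Ft where "Ft x t = - (1 + R x) * Et x t / (E x t)\<^sup>2" for x t
  define Ftt where "Ftt x t = - (1 + R x) * ((2 * T x t - J x t) / (E x t)\<^sup>2 - 2 * (Et x t)\<^sup>2 / (E x t) ^ 3)" for x t
  define c where "c x = 8 * R x / (1 - (R x)\<^sup>2)" for x
  define \<mu> where "\<mu> x = ((1 + R x) / (1 - R x))\<^sup>2" for x
  have identity: "Fxx x t + Ftt x t + c x * Fx x t
      = (1 + R x) / E x t * (8 * ((Ex x t / 2 / E x t - R x / (1 + R x))\<^sup>2 + (Et x t / 2 / E x t)\<^sup>2)
        + 4 * R x / ((1 - R x) * E x t) * (- defect_fun \<phi> \<psi> (exp (?s x t))))"
    and TE: "T x t * E x t = (Ex x t / 2)\<^sup>2 + (Et x t / 2)\<^sup>2 + R x"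
    and Veq: "defect_fun \<phi> \<psi> (exp (?s x t)) = (1 - R x) * T x t / R x + Ex x t - E x t"
    if x: "x < 0" for x t
  proof -
    define s where "s = ?s x t"
    define z where "z = exp s"
    have zD: "z \<in> ?D" using expH sH[OF x] by (simp add: z_def s_def)
    have z2: "(cmod z)\<^sup>2 = R x" using cmodz[of x t] by (simp add: z_def s_def)
    have in_Re: "u \<bullet> v = Re (v * cnj u)" "u \<bullet> (\<i> * v) = - Im (v * cnj u)" for u v
      by (simp_all add: inner_complex_def algebra_simps)
    define K where "K = a1 s * cnj (a s) + p1 s * cnj (p s)"
    have KR: "Ex x t / 2 = Re K" and KI: "Et x t / 2 = - Im K"
      by (simp_all add: Ex_def Et_def K_def in_Re s_def)
    have "a s * p1 s - a1 s * p s = z * (\<phi> z * deriv \<psi> z - deriv \<phi> z * \<psi> z)"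
      by (simp add: a_def a1_def p_def p1_def z_def algebra_simps)
    then have "a s * p1 s - a1 s * p s = z" using wr[OF zD] by simp
    then show TE: "T x t * E x t = (Ex x t / 2)\<^sup>2 + (Et x t / 2)\<^sup>2 + R x"
      unfolding T_def E_def s_def[symmetric] KR KI lagrange_identity_complex K_def[symmetric]
      by (simp only: z2) (simp add: cmod_power2)
    have Tz: "T x t / R x = (cmod (deriv \<phi> z))\<^sup>2 + (cmod (deriv \<psi> z))\<^sup>2"
      using R01[OF x] unfolding T_def s_def[symmetric] a1_def p1_def z_def[symmetric]
      by (simp add: norm_mult power_mult_distrib z2 add_divide_distrib)
    have Kz: "Re K = Re (z * (deriv \<phi> z * cnj (\<phi> z) + deriv \<psi> z * cnj (\<psi> z)))"
      by (simp add: K_def a_def a1_def p_def p1_def z_def algebra_simps)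
    have "defect_fun \<phi> \<psi> z = (1 - R x) * (T x t / R x) + 2 * (Ex x t / 2) - E x t"
      unfolding defect_fun_def defect_expand z2 Tz KR Kz
      by (simp add: E_def a_def p_def z_def s_def)
    then show Veq: "defect_fun \<phi> \<psi> (exp (?s x t)) = (1 - R x) * T x t / R x + Ex x t - E x t"
      by (simp add: z_def s_def)
    have squares: "(Ex x t / 2)\<^sup>2 + (Et x t / 2)\<^sup>2 = ((Ex x t)\<^sup>2 + (Et x t)\<^sup>2) / 4"
      by (simp add: power_divide add_divide_distrib)
    have "Fxx x t + Ftt x t + c x * Fx x t =
      4 * R x / E x t - 4 * R x * (2 * (Ex x t / 2)) / (E x t)\<^sup>2
      - (1 + R x) * (4 * T x t / (E x t)\<^sup>2 - 8 * ((Ex x t / 2)\<^sup>2 + (Et x t / 2)\<^sup>2) / (E x t) ^ 3)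
      + 8 * R x / (1 - (R x)\<^sup>2) * (2 * R x / E x t - (1 + R x) * (2 * (Ex x t / 2)) / (E x t)\<^sup>2)"
      unfolding Fxx_def Ftt_def c_def Fx_def squares
      by (simp add: diff_divide_distrib add_divide_distrib algebra_simps)
    also note liouville_quotient_identity[OF R01[OF x] Epos[OF x] TE]
    also have "E x t - (1 - R x) * T x t / R x - 2 * (Ex x t / 2) = - defect_fun \<phi> \<psi> (exp (?s x t))"
      unfolding Veq by simp
    finally show "Fxx x t + Ftt x t + c x * Fx x t
      = (1 + R x) / E x t * (8 * ((Ex x t / 2 / E x t - R x / (1 + R x))\<^sup>2 + (Et x t / 2 / E x t)\<^sup>2)
        + 4 * R x / ((1 - R x) * E x t) * (- defect_fun \<phi> \<psi> (exp (?s x t))))" .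
  qed
  have Enz: "E x t \<noteq> 0" if "x < 0" for x t using Epos[OF that, of t] by simp
  have F1: "((\<lambda>x. F x t) has_real_derivative Fx x t) (at x)" if x: "x < 0" for x t
    unfolding F_def Fx_def
    by (rule DERIV_cong[OF DERIV_over[OF DERIV_add[OF DERIV_const DR] DE(1)[OF x] Enz[OF x]]]) simp
  have F2: "((\<lambda>x. Fx x t) has_real_derivative Fxx x t) (at x)" if x: "x < 0" for x t
    unfolding Fx_def Fxx_def
    by (rule DERIV_cong[OF DERIV_diff[OF DERIV_over[OF DERIV_cmult[OF DR] DE(1)[OF x] Enz[OF x]]
          DERIV_over_square[OF DERIV_mult[OF DERIV_add[OF DERIV_const DR] DE(2)[OF x]] DE(1)[OF x] Enz[OF x]]]])
       (simp add: algebra_simps add_divide_distrib diff_divide_distrib power2_eq_square)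
  have Ft: "((\<lambda>t. Ft x t) has_real_derivative Ftt x t) (at t)" if x: "x < 0" for x t
    unfolding Ft_def Ftt_def
    by (rule DERIV_cong[OF DERIV_over_square[OF DERIV_cmult[OF DE(4)[OF x]] DE(3)[OF x] Enz[OF x]]])
       (simp add: algebra_simps add_divide_distrib diff_divide_distrib power2_eq_square)
  note defs = E_def Ex_def Et_def J_def T_def R_def
  have cE: "continuous_on ({..<0} \<times> UNIV) (\<lambda>y. E (fst y) (snd y))"
    "continuous_on ({..<0} \<times> UNIV) (\<lambda>y. Ex (fst y) (snd y))"
    "continuous_on ({..<0} \<times> UNIV) (\<lambda>y. Et (fst y) (snd y))"
    "continuous_on ({..<0} \<times> UNIV) (\<lambda>y. J (fst y) (snd y))"
    "continuous_on ({..<0} \<times> UNIV) (\<lambda>y. T (fst y) (snd y))"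
    "continuous_on ({..<0} \<times> UNIV) (\<lambda>y::real \<times> real. R (fst y))"
    unfolding defs by (intro continuous_intros ct)+
  have cF: "continuous_on ({..<0} \<times> UNIV) (\<lambda>(x, t). F x t)"
    "continuous_on ({..<0} \<times> UNIV) (\<lambda>(x, t). Fx x t)"
    "continuous_on ({..<0} \<times> UNIV) (\<lambda>(x, t). Fxx x t)"
    "continuous_on ({..<0} \<times> UNIV) (\<lambda>(x, t). Ftt x t)"
    unfolding F_def Fx_def Fxx_def Ftt_def case_prod_unfold
    by (intro continuous_intros cE; use Enz in force)+
  have per: "Ft x (2 * pi) = Ft x 0" if "x < 0" for x
  proof -
    have "exp (?s x (2 * pi)) = exp (?s x 0)"
      by (simp add: log_polar_def exp_add mult.commute)
    then show ?thesis
      unfolding Ft_def Et_def E_def a_def a1_def p_def p1_def by simp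
  qed
  \<comment> \<open>bounds for \<open>x \<rightarrow> -\<infinity>\<close> come from continuity of \<open>(1 + |z|\<^sup>2) / N\<close> at 0; the radius \<open>exp (- 1)\<close> is arbitrary\<close>
  obtain B where B: "\<And>x t. x \<le> - 1 \<Longrightarrow> F x t \<le> B"
  proof -
    let ?r = "exp (- 1 :: real)"
    have sub: "cball 0 ?r \<subseteq> ?D" by (auto simp: le_less_trans)
    have Nnz: "N z \<noteq> 0" if "z \<in> ?D" for z
      using wr[OF that] unfolding N_def by (auto simp: add_nonneg_eq_0_iff)
    have "continuous_on ?D (\<lambda>z. (1 + (cmod z)\<^sup>2) / N z)"
      using Nnz unfolding N_def
      by (intro continuous_intros holomorphic_on_imp_continuous_on hol) auto
    then have "continuous_on (cball 0 ?r) (\<lambda>z. (1 + (cmod z)\<^sup>2) / N z)"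
      using sub continuous_on_subset by blast
    then have "compact ((\<lambda>z. (1 + (cmod z)\<^sup>2) / N z) ` cball 0 ?r)"
      using compact_cball by (rule compact_continuous_image)
    then have "bounded ((\<lambda>z. (1 + (cmod z)\<^sup>2) / N z) ` cball 0 ?r)"
      by (rule compact_imp_bounded)
    then obtain B where "\<forall>v \<in> (\<lambda>z. (1 + (cmod z)\<^sup>2) / N z) ` cball 0 ?r. norm v \<le> B"
      unfolding bounded_iff by metis
    then have B: "\<bar>(1 + (cmod z)\<^sup>2) / N z\<bar> \<le> B" if "z \<in> cball 0 ?r" for z
      unfolding real_norm_def using that by simp
    have "F x t \<le> B" if "x \<le> - 1" for x t
    proof -
      have "exp (?s x t) \<in> cball 0 ?r" using that by (simp add: log_polar_def)
      from B[OF this] show ?thesis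
        unfolding cmodz F_def E_def N_def a_def p_def by linarith
    qed
    then show ?thesis using that by blast
  qed
  have \<mu>: "(\<mu> has_real_derivative c x * \<mu> x) (at x)" "\<mu> x > 0" "c x \<ge> 0" if x: "x < 0" for x
  proof -
    have n: "1 - R x \<noteq> 0" "1 + R x \<noteq> 0" using R01[OF x] by auto
    have R2: "1 - (R x)\<^sup>2 = (1 - R x) * (1 + R x)" by (simp add: power2_eq_square algebra_simps)
    have val: "8 * R x / (1 - (R x)\<^sup>2) * ((1 + R x) / (1 - R x))\<^sup>2 = 8 * R x * (1 + R x) / (1 - R x) ^ 3"
      unfolding R2 using n by (simp add: divide_simps power2_eq_square power3_eq_cube)
    have q: "((\<lambda>x. (1 + R x) / (1 - R x)) has_real_derivative 4 * R x / (1 - R x)\<^sup>2) (at x)"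
      by (rule DERIV_cong[OF DERIV_divide[OF DERIV_add[OF DERIV_const DR] DERIV_diff[OF DERIV_const DR] n(1)]])
         (simp add: power2_eq_square algebra_simps)
    show "(\<mu> has_real_derivative c x * \<mu> x) (at x)"
      unfolding \<mu>_def c_def val
      by (rule DERIV_cong[OF DERIV_power[OF q]]) (simp add: power2_eq_square power3_eq_cube)
    show "\<mu> x > 0" using R01[OF x] by (simp add: \<mu>_def)
    have "(R x)\<^sup>2 < 1" using R01[OF x] by (simp add: abs_square_less_1)
    then show "c x \<ge> 0" using R01[OF x] by (simp add: c_def)
  qed
  have Q: "Fxx x t + Ftt x t + c x * Fx x t \<ge> 0" if x: "x < 0" for x t
    unfolding identity[OF x] using R01[OF x] Epos[OF x, of t] V[OF expH[OF sH[OF x, of t]]]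
    by (intro mult_nonneg_nonneg add_nonneg_nonneg divide_nonneg_nonneg) auto
  note mean = mean_monotone_of_subsolution[where l = "2 * pi" and ?x1.0 = "- 1", OF _ F1 F2 cF(1,2,3) Ft cF(4) per B \<mu> Q]
  have MF: "M = (\<lambda>x. integral {0..2 * pi} (F x))"
    unfolding M_def N_def F_def E_def R_def a_def p_def ..
  define D where "D = integral {0..2 * pi} (Fx x0)"
  have "(M has_real_derivative D) (at x0)"
    unfolding MF D_def by (rule mean(1)) (use x0 in auto)
  moreover have "D \<ge> 0" unfolding D_def by (rule mean(2)) (use x0 in auto)
  moreover have "N z = 1 + (cmod z)\<^sup>2 \<and> (cmod (deriv \<phi> z))\<^sup>2 + (cmod (deriv \<psi> z))\<^sup>2 = 1"
    if D0: "D = 0" and z: "0 < cmod z" "cmod z < exp x0" for z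
  proof -
    define x t where "x = ln (cmod z)" and "t = Arg2pi z"
    have "ln (cmod z) < ln (exp x0)" using z by (subst ln_less_cancel_iff) auto
    then have xx: "x < x0" by (simp add: x_def)
    then have x: "x < 0" using x0 by simp
    have t: "t \<in> {0..2 * pi}" using Arg2pi_ge_0[of z] Arg2pi_lt_2pi[of z] by (simp add: t_def)
    have zs: "exp (?s x t) = z"
      using Arg2pi_eq[of z] z(1)
      by (simp add: log_polar_def x_def t_def exp_add exp_of_real mult.commute)
    have "Fxx x t + Ftt x t + c x * Fx x t = 0"
      by (rule mean(3)[of x0]) (use D0 xx x0 t in \<open>auto simp: D_def\<close>)
    moreover define e where "e = E x t"
    define k1 k2 where "k1 = Ex x t / 2" and "k2 = Et x t / 2"
    define r where "r = R x"
    have e: "e > 0" and r: "0 < r" "r < 1" using Epos[OF x] R01[OF x] by (auto simp: e_def r_def)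
    have v: "defect_fun \<phi> \<psi> z \<le> 0" using V[OF expH[OF sH[OF x, of t]]] zs by simp
    ultimately have zero: "(1 + r) / e * (8 * ((k1 / e - r / (1 + r))\<^sup>2 + (k2 / e)\<^sup>2)
        + 4 * r / ((1 - r) * e) * (- defect_fun \<phi> \<psi> z)) = 0"
      using identity[OF x, of t] zs by (simp add: e_def k1_def k2_def r_def)
    have sum0: "8 * ((k1 / e - r / (1 + r))\<^sup>2 + (k2 / e)\<^sup>2)
        + 4 * r / ((1 - r) * e) * (- defect_fun \<phi> \<psi> z) = 0"
      using zero e r by simp
    have pos: "4 * r / ((1 - r) * e) > 0" using e r by simp
    have nn: "4 * r / ((1 - r) * e) * (- defect_fun \<phi> \<psi> z) \<ge> 0"
      using pos v by (intro mult_nonneg_nonneg) auto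
    have "u = 0 \<and> v = 0 \<and> w = 0" if "8 * (u + v) + w = 0" "u \<ge> 0" "v \<ge> 0" "w \<ge> 0" for u v w :: real
    proof -
      have "8 * u + 8 * v + w = 0" using that(1) by simp
      then have "u \<le> 0" "v \<le> 0" "w \<le> 0" using that(2-4) by linarith+
      then show ?thesis using that(2-4) by simp
    qed
    from this[OF sum0 zero_le_power2 zero_le_power2 nn]
    have "(k1 / e - r / (1 + r))\<^sup>2 = 0" "(k2 / e)\<^sup>2 = 0"
      "4 * r / ((1 - r) * e) * (- defect_fun \<phi> \<psi> z) = 0" by blast+
    then have k: "k1 = r * e / (1 + r)" "k2 = 0" and v0: "defect_fun \<phi> \<psi> z = 0"
      using e pos by (auto simp: field_simps)
    \<comment> \<open>the square and the defect vanish: two linear equations for \<open>k1\<close> and \<open>\<tau>\<close> in terms of \<open>e\<close>, whose solution \<open>k1 = \<tau> = r e / (1 + r)\<close> then fixes \<open>e\<close>\<close>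
    define \<tau> where "\<tau> = T x t"
    have te: "\<tau> * e = k1\<^sup>2 + k2\<^sup>2 + r" using TE[OF x, of t] by (simp add: \<tau>_def e_def k1_def k2_def r_def)
    have "(1 - r) * \<tau> / r + 2 * k1 - e = 0"
      using Veq[OF x, of t] v0 zs by (simp add: \<tau>_def e_def k1_def r_def)
    then have "(1 - r) * \<tau> / r = e - 2 * k1" by linarith
    then have "(1 - r) * \<tau> = (e - 2 * k1) * r" using r by (simp add: field_simps)
    then have "(1 - r) * \<tau> * (1 + r) = e * r * (1 + r) - 2 * r * (k1 * (1 + r))"
      by algebra
    moreover have k1r: "k1 * (1 + r) = r * e" using r k by simp
    ultimately have t1: "(1 - r) * \<tau> * (1 + r) + 2 * r * (r * e) = e * r * (1 + r)" by simp
    have "(1 - r) * (\<tau> * (1 + r)) = (1 - r) * (r * e)"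
      using t1 by (simp add: algebra_simps)
    then have t2: "\<tau> * (1 + r) = r * e" using r by simp
    have "k1 * (1 + r) = \<tau> * (1 + r)" using t2 k1r by simp
    then have k1t: "k1 = \<tau>" using r by simp
    have "\<tau> * e = \<tau>\<^sup>2 + r" using te k(2) k1t by simp
    with t2 have "r * (e * e) = r * (1 + r)\<^sup>2" by algebra
    then have "e\<^sup>2 = (1 + r)\<^sup>2" using r by (simp add: power2_eq_square)
    then have e1: "e = 1 + r" using e r by (simp add: power2_eq_iff_nonneg)
    then have tr: "\<tau> = r" using t2 r by simp
    have zr: "(cmod z)\<^sup>2 = r" using cmodz[of x t] zs by (simp add: r_def)
    have "N z = e" by (simp add: N_def e_def E_def a_def p_def zs)
    moreover have "\<tau> = r * ((cmod (deriv \<phi> z))\<^sup>2 + (cmod (deriv \<psi> z))\<^sup>2)"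
      unfolding \<tau>_def T_def a1_def p1_def zs by (simp add: norm_mult power_mult_distrib zr algebra_simps)
    ultimately show ?thesis using e1 tr r zr by simp
  qed
  ultimately show ?thesis by blast
qed

section \<open>Equality and the monotonicity of the length ratio\<close>

text \<open>
  At 0 the equations give \<open>|\<phi>| = 1\<close>, hence \<open>|g'| = 1\<close> and \<open>|\<psi>'| = 1\<close>, while \<open>|\<psi>'| \<le> 1\<close> nearby. By the
  maximum modulus principle \<open>\<psi>'\<close> is constant, so \<open>\<phi>'\<close> and with it \<open>g''\<close> vanish near 0, and
  \<open>g\<close> is linear by the identity theorem.
\<close>

lemma rigidity_of_equality:
  assumes hol: "g holomorphic_on ball 0 1" and g0: "g 0 = 0"
    and hol2: "\<phi> holomorphic_on ball 0 1" "\<psi> holomorphic_on ball 0 1"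
    and sq: "\<And>z. z \<in> ball 0 1 \<Longrightarrow> (\<phi> z)\<^sup>2 * deriv g z = 1"
    and d\<phi>: "\<And>z. z \<in> ball 0 1 \<Longrightarrow> 2 * deriv \<phi> z * deriv g z = - \<phi> z * deriv (deriv g) z"
    and \<psi>: "\<And>z. z \<in> ball 0 1 \<Longrightarrow> \<psi> z = g z * \<phi> z"
    and d\<psi>: "\<And>z. z \<in> ball 0 1 \<Longrightarrow> deriv \<psi> z = deriv g z * \<phi> z + g z * deriv \<phi> z"
    and r: "0 < r" "r < 1"
    and eq: "\<And>z. 0 < cmod z \<Longrightarrow> cmod z < r \<Longrightarrow> (cmod (\<phi> z))\<^sup>2 + (cmod (\<psi> z))\<^sup>2 = 1 + (cmod z)\<^sup>2"
      "\<And>z. 0 < cmod z \<Longrightarrow> cmod z < r \<Longrightarrow> (cmod (deriv \<phi> z))\<^sup>2 + (cmod (deriv \<psi> z))\<^sup>2 = 1"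
  shows "\<exists>\<theta>. \<forall>z\<in>ball 0 1. g z = cis \<theta> * z"
proof -
  let ?D = "ball (0::complex) 1"
  have at0: "F 0 = G 0" if "continuous_on ?D F" "continuous_on ?D G"
    "\<And>z. 0 < cmod z \<Longrightarrow> cmod z < r \<Longrightarrow> F z = G z" for F G :: "complex \<Rightarrow> real"
  proof (rule tendsto_unique[of "at (0::complex)"])
    have "isCont F 0" "isCont G 0"
      using that(1,2) by (auto simp: continuous_on_eq_continuous_at)
    then have G: "(G \<longlongrightarrow> G 0) (at 0)" by (simp add: isCont_def)
    show "(F \<longlongrightarrow> F 0) (at 0)" using \<open>isCont F 0\<close> by (simp add: isCont_def)
    show "(F \<longlongrightarrow> G 0) (at 0)"
    proof (rule Lim_transform_within[OF G r(1)])
      fix z :: complex assume "0 < dist z 0" "dist z 0 < r"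
      then show "G z = F z" using that(3)[of z] by simp
    qed
  qed simp
  have c: "continuous_on ?D \<phi>" "continuous_on ?D \<psi>" "continuous_on ?D (deriv \<phi>)" "continuous_on ?D (deriv \<psi>)"
    using hol2 by (auto intro!: holomorphic_on_imp_continuous_on holomorphic_deriv)
  have "(cmod (\<phi> 0))\<^sup>2 + (cmod (\<psi> 0))\<^sup>2 = 1 + (cmod 0)\<^sup>2"
    by (rule at0) (use eq(1) in \<open>auto intro!: continuous_intros c\<close>)
  then have \<phi>0: "cmod (\<phi> 0) = 1" using \<psi>[of 0] g0 by (simp add: power2_eq_1_iff) (smt (verit) norm_ge_zero)
  have "cmod (deriv g 0) = 1"
    using arg_cong[OF sq[of 0], of cmod] \<phi>0 by (simp add: norm_mult norm_power)
  then have \<psi>0: "cmod (deriv \<psi> 0) = 1" using d\<psi>[of 0] g0 \<phi>0 by (simp add: norm_mult)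
  have eq0: "(cmod (deriv \<phi> 0))\<^sup>2 + (cmod (deriv \<psi> 0))\<^sup>2 = 1"
    by (rule at0[of _ "\<lambda>_. 1"]) (use eq(2) in \<open>auto intro!: continuous_intros c\<close>)
  have "deriv \<psi> constant_on ?D"
  proof (rule maximum_modulus_principle[where U = "ball 0 r" and \<xi> = 0])
    show "cmod (deriv \<psi> z) \<le> cmod (deriv \<psi> 0)" if "z \<in> ball 0 r" for z
    proof (cases "z = 0")
      case False
      have "(cmod (deriv \<psi> z))\<^sup>2 \<le> 1\<^sup>2" using eq(2)[of z] that False by (smt (verit) mem_ball_0 one_power2 zero_le_power2 zero_less_norm_iff)
      then show ?thesis unfolding \<psi>0 by (rule power2_le_imp_le) simp
    qed simp
  qed (use r hol2 in \<open>auto intro: holomorphic_deriv\<close>)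
  then have \<psi>c: "cmod (deriv \<psi> z) = 1" if "z \<in> ball 0 r" for z
    using \<psi>0 that r unfolding constant_on_def by (metis centre_in_ball mem_ball_0 order_less_trans zero_less_one)
  have ddg: "deriv (deriv g) z = 0" if "z \<in> ball 0 r - {0}" for z
  proof -
    have "deriv \<phi> z = 0" using eq(2)[of z] \<psi>c[of z] that by simp
    moreover have zD: "z \<in> ?D" using that r by simp
    moreover have "\<phi> z \<noteq> 0" using sq[OF zD] by auto
    ultimately show ?thesis using d\<phi>[of z] by simp
  qed
  have ddg_all: "deriv (deriv g) z = 0" if "z \<in> ?D" for z
  proof (rule analytic_continuation_open[of "ball 0 r - {0}" ?D "deriv (deriv g)" "\<lambda>_. 0"])
    have "of_real (r / 2) \<in> ball (0::complex) r - {0}" using r by simp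
    then show "ball (0::complex) r - {0} \<noteq> {}" by blast
    show "deriv (deriv g) holomorphic_on ?D" by (intro holomorphic_deriv hol open_ball)
  qed (use r that ddg in \<open>auto simp: open_delete\<close>)
  have "\<exists>c. \<forall>z\<in>?D. deriv g z = c"
  proof (rule has_field_derivative_zero_constant)
    show "(deriv g has_field_derivative 0) (at z within ?D)" if "z \<in> ?D" for z
      using holomorphic_derivI[OF holomorphic_deriv[OF hol open_ball] open_ball that] ddg_all[OF that]
      by (simp add: has_field_derivative_at_within)
  qed simp
  then obtain c where "\<forall>z\<in>?D. deriv g z = c" by blast
  then have dg: "deriv g z = deriv g 0" if "z \<in> ?D" for z using that by simp
  have "\<exists>c. \<forall>z\<in>?D. g z - deriv g 0 * z = c"
  proof (rule has_field_derivative_zero_constant)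
    show "((\<lambda>z. g z - deriv g 0 * z) has_field_derivative 0) (at z within ?D)" if "z \<in> ?D" for z
      by (rule has_field_derivative_at_within, rule DERIV_cong,
          rule DERIV_diff[OF holomorphic_derivI[OF hol open_ball that] DERIV_cmult_Id])
         (simp add: dg[OF that])
  qed simp
  then obtain b where b: "\<forall>z\<in>?D. g z - deriv g 0 * z = b" by blast
  have "b = 0" using bspec[OF b, of 0] g0 by simp
  then have "g z = deriv g 0 * z" if "z \<in> ?D" for z using b that by simp
  moreover have "deriv g 0 = cis (Arg (deriv g 0))"
    using rcis_cmod_Arg[of "deriv g 0"] \<open>cmod (deriv g 0) = 1\<close> by (simp add: rcis_def)
  ultimately show ?thesis by metis
qed

theorem theorem1p5:
  fixes f :: "complex \<Rightarrow> riemann_sphere"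
  assumes "spherically_convex_function f"
    and "centrally_normalized f"
  shows "(\<not> spherical_isometry f \<longrightarrow> strict_mono_on {0<..<1} (spherical_length_ratio f))
       \<and> (spherical_isometry f \<longrightarrow> (\<forall>r\<in>{0<..<1}. spherical_length_ratio f r = 1))"
proof -
  let ?D = "ball (0::complex) 1"
  define g where "g = affine_part f"
  have f0: "f 0 = Some 0" using assms(2) by (simp add: centrally_normalized_def)
  have mer: "meromorphic_map_on f ?D" and injf: "inj_on f ?D"
    and conv: "spherically_convex_domain (f ` ?D)"
    using assms(1) unfolding spherically_convex_function_def by auto
  have fg: "f z = Some (g z)" if "z \<in> ?D" for z
    using spherically_convex_function_no_pole[OF assms(1) f0 that] by (auto simp: g_def affine_part_def)
  have g0: "g 0 = 0" using fg[of 0] f0 by simp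
  have hol: "g holomorphic_on ?D"
  proof -
    have "g analytic_on {z}" if z: "z \<in> ?D" for z
      unfolding g_def
    proof (rule nicely_meromorphic_on_imp_analytic_at[OF _ z])
      show "affine_part f nicely_meromorphic_on ?D" using mer by (simp add: meromorphic_map_on_def)
      show "\<not> is_pole (affine_part f) z"
        using mer fg[OF z] z unfolding meromorphic_map_on_def by (metis option.distinct(1))
    qed
    then show ?thesis using analytic_imp_holomorphic analytic_on_analytic_at by blast
  qed
  have inj: "inj_on g ?D" using injf fg unfolding inj_on_def by metis
  have "f ` ?D = Some ` g ` ?D" using fg by (auto simp: image_image)
  then have convg: "spherically_convex_domain (Some ` g ` ?D)" using conv by simp
  have sd: "spherical_deriv f z = cmod (deriv g z) / (1 + (cmod (g z))\<^sup>2)" if "z \<in> ?D" for z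
    using fg[OF that] by (simp add: spherical_deriv_def g_def)
  have ball: "of_real r * cis t \<in> ?D" if "r \<in> {0<..<1}" for r t
    using that by (simp add: norm_mult)
  have iso: "spherical_isometry f \<longleftrightarrow> (\<exists>\<theta>. \<forall>z\<in>?D. g z = cis \<theta> * z)"
  proof
    assume "\<exists>\<theta>. \<forall>z\<in>?D. g z = cis \<theta> * z"
    then obtain \<theta> where \<theta>: "\<forall>z\<in>?D. g z = cis \<theta> * z" by blast
    have "moebius_map (cis \<theta>) (- (cis \<theta> * 0)) (cnj 0) 1 \<in> Rot" unfolding Rot_def by blast
    moreover have "\<forall>z\<in>?D. f z = moebius_map (cis \<theta>) (- (cis \<theta> * 0)) (cnj 0) 1 (Some z)"
      using fg \<theta> by (simp add: moebius_map_def)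
    ultimately show "spherical_isometry f" unfolding spherical_isometry_def by blast
  next
    assume "spherical_isometry f"
    then obtain Q where Q: "Q \<in> Rot" "\<forall>z\<in>?D. f z = Q (Some z)" unfolding spherical_isometry_def by blast
    have Q0: "Q (Some 0) = Some 0" using Q(2) f0 by force
    from Q(1) consider a \<theta> where "Q = moebius_map (cis \<theta>) (- (cis \<theta> * a)) (cnj a) 1"
      | \<theta> where "Q = moebius_map 0 (cis \<theta>) 1 0" unfolding Rot_def by blast
    then show "\<exists>\<theta>. \<forall>z\<in>?D. g z = cis \<theta> * z"
    proof cases
      case 1
      have "a = 0" using Q0 by (simp add: 1 moebius_map_def)
      then have "g z = cis \<theta> * z" if "z \<in> ?D" for z
        using Q(2) fg[OF that] that by (simp add: 1 moebius_map_def)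
      then show ?thesis by blast
    next
      case 2
      then show ?thesis using Q0 by (simp add: moebius_map_def)
    qed
  qed
  show ?thesis
  proof (intro conjI impI)
    assume "spherical_isometry f"
    then obtain \<theta> where \<theta>: "\<And>z. z \<in> ?D \<Longrightarrow> g z = cis \<theta> * z" using iso by blast
    have sd1: "spherical_deriv f z = 1 / (1 + (cmod z)\<^sup>2)" if z: "z \<in> ?D" for z
    proof -
      have "(g has_field_derivative cis \<theta>) (at z)"
        by (rule has_field_derivative_transform_within_open[of "\<lambda>z. cis \<theta> * z" _ _ ?D])
           (use z \<theta> in \<open>auto intro!: derivative_eq_intros\<close>)
      then show ?thesis using sd[OF z] \<theta>[OF z] by (simp add: DERIV_imp_deriv norm_mult)
    qed
    show "\<forall>r\<in>{0<..<1}. spherical_length_ratio f r = 1"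
    proof
      fix r :: real assume r: "r \<in> {0<..<1}"
      have "spherical_length_image f r = spherical_length_circle r"
        unfolding spherical_length_image_def spherical_length_circle_def circle_integral_def
        using sd1[OF ball[OF r]] by simp
      moreover have "spherical_length_circle r > 0"
        unfolding spherical_length_circle_eq using r by (auto intro!: divide_pos_pos add_pos_nonneg)
      ultimately show "spherical_length_ratio f r = 1" by (simp add: spherical_length_ratio_def)
    qed
  next
    assume niso: "\<not> spherical_isometry f"
    obtain \<phi> \<psi> where hol2: "\<phi> holomorphic_on ?D" "\<psi> holomorphic_on ?D"
      and sq: "\<And>z. z \<in> ?D \<Longrightarrow> (\<phi> z)\<^sup>2 * deriv g z = 1"
      and d\<phi>: "\<And>z. z \<in> ?D \<Longrightarrow> 2 * deriv \<phi> z * deriv g z = - \<phi> z * deriv (deriv g) z"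
      and \<psi>: "\<And>z. z \<in> ?D \<Longrightarrow> \<psi> z = g z * \<phi> z"
      and d\<psi>: "\<And>z. z \<in> ?D \<Longrightarrow> deriv \<psi> z = deriv g z * \<phi> z + g z * deriv \<phi> z"
      using univalent_liouville_pair[OF hol inj] by metis
    have wr: "\<phi> z * deriv \<psi> z - deriv \<phi> z * \<psi> z = 1" if "z \<in> ?D" for z
      using sq[OF that] unfolding \<psi>[OF that] d\<psi>[OF that] by (simp add: power2_eq_square algebra_simps)
    have V: "defect_fun \<phi> \<psi> z \<le> 0" if "z \<in> ?D" for z
      by (rule spherically_convex_defect_nonpos[OF hol inj convg g0 hol2 sq d\<phi> \<psi> d\<psi> that])
    define N where "N z = (cmod (\<phi> z))\<^sup>2 + (cmod (\<psi> z))\<^sup>2" for z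
    define M where "M x = integral {0..2 * pi} (\<lambda>t. (1 + exp (2 * x)) / N (exp (log_polar x t)))" for x
    have sdN: "spherical_deriv f z = 1 / N z" if z: "z \<in> ?D" for z
    proof -
      have "N z = (cmod (\<phi> z))\<^sup>2 * (1 + (cmod (g z))\<^sup>2)"
        by (simp add: N_def \<psi>[OF z] norm_mult power_mult_distrib algebra_simps)
      moreover have "(cmod (\<phi> z))\<^sup>2 * cmod (deriv g z) = 1"
        using arg_cong[OF sq[OF z], of cmod] by (simp add: norm_mult norm_power)
      then have "cmod (deriv g z) = 1 / (cmod (\<phi> z))\<^sup>2"
        by (metis mult_zero_left nonzero_mult_div_cancel_left zero_neq_one)
      ultimately show ?thesis
        unfolding sd[OF z] by simp
    qed
    have ratio: "spherical_length_ratio f r = M (ln r) / (2 * pi)" if r: "r \<in> {0<..<1}" for r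
    proof -
      have r0: "r > 0" using r by simp
      have e2: "exp (2 * ln r) = r\<^sup>2" using r0 by (simp add: exp_double)
      have pt: "exp (log_polar (ln r) t) = of_real r * cis t" for t
        using r0 by (simp add: log_polar_def exp_add cis_conv_exp mult.commute exp_of_real)
      have "M (ln r) = integral {0..2 * pi} (\<lambda>t. ((1 + r\<^sup>2) / r) * (spherical_deriv f (of_real r * cis t) * r))"
        unfolding M_def e2 pt sdN[OF ball[OF r]] using r0 by simp
      also have "\<dots> = ((1 + r\<^sup>2) / r) * spherical_length_image f r"
        unfolding spherical_length_image_def circle_integral_def by (rule integral_mult_right)
      finally show ?thesis
        unfolding spherical_length_ratio_def spherical_length_circle_eq by (simp add: mult.commute mult.left_commute)
    qed
    have M': "\<exists>D>0. (M has_real_derivative D) (at x)" if x: "x < 0" for x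
    proof -
      obtain D where D: "D \<ge> 0" "(M has_real_derivative D) (at x)"
        and rig: "D = 0 \<Longrightarrow> \<forall>z. 0 < cmod z \<and> cmod z < exp x \<longrightarrow> N z = 1 + (cmod z)\<^sup>2 \<and>
            (cmod (deriv \<phi> z))\<^sup>2 + (cmod (deriv \<psi> z))\<^sup>2 = 1"
        using circular_mean_of_quotient[OF hol2 wr V x] unfolding M_def[abs_def] N_def by blast
      have "D \<noteq> 0"
      proof
        assume "D = 0"
        from rig[OF this] have "\<exists>\<theta>. \<forall>z\<in>?D. g z = cis \<theta> * z"
          by (intro rigidity_of_equality[OF hol g0 hol2 sq d\<phi> \<psi> d\<psi>, of "exp x"]) (use x in \<open>auto simp: N_def\<close>)
        then show False using iso niso by blast
      qed
      then show ?thesis using D by (intro exI[of _ D]) auto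
    qed
    show "strict_mono_on {0<..<1} (spherical_length_ratio f)"
    proof (rule strict_mono_onI)
      fix r s :: real assume rs: "r \<in> {0<..<1}" "s \<in> {0<..<1}" "r < s"
      have "M (ln r) < M (ln s)"
      proof (rule DERIV_pos_imp_increasing[where f = M])
        show "ln r < ln s" using rs by simp
        show "\<exists>y. (M has_real_derivative y) (at x) \<and> 0 < y" if "ln r \<le> x" "x \<le> ln s" for x
        proof -
          have "ln s < 0" using rs by simp
          then show ?thesis using M'[of x] that by auto
        qed
      qed
      then show "spherical_length_ratio f r < spherical_length_ratio f s"
        using ratio rs by (simp add: divide_strict_right_mono)
    qed
  qed
qed

end
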